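(* Let $d\ge2$, let $h$ be the log-correlated Gaussian field on $\mathbb R^d$, let $p\in(0,1]$, and let $\rho,\sigma$ be admissible mollifiers on $\mathbb R^d$ satisfying Condition $(A_p)$. Define $X(z,\epsilon):=h_\epsilon^\rho(z)-h_\epsilon^\sigma(z)$. Then for every bounded open set $U\subset\mathbb R^d$, $$\sup_{z\in U}\frac{|X(z,\epsilon)|}{\log(1/\epsilon)}\to0\qquad\text{almost surely as }\epsilon\to0.$$
   Context: Let $\mathcal S(\mathbb R^d)$ be the Schwartz space and $\mathcal S_0(\mathbb R^d)=\{f\in\mathcal S(\mathbb R^d):\int f\,dx=0\}$. The log-correlated Gaussian field (LGF) $h$ on $\mathbb R^d$ is the centered Gaussian random tempered distribution modulo additive constants with $$\operatorname{Cov}[(h,f_1),(h,f_2)]=\iint_{\mathbb R^d\times\mathbb R^d}\log\frac1{|x-y|}f_1(x)f_2(y)\,dx\,dy,\qquad f_1,f_2\in\mathcal S_0(\mathbb R^d).$$ The additive constant is fixed by requiring that the average of $h$ over the unit sphere is $0$ (i.e. $h$ is replaced by $h-h_1(0)$, with $h_1(0)$ the average of $h$ over the unit sphere centered at $0$), so that $(h,f)$ is defined for smooth compactly supported $f$ with $\int f=1$. An admissible mollifier is a nonnegative Radon measure $\rho$ on $\mathbb R^d$ such that (i) $\operatorname{supp}(\rho)\subseteq\overline{B(0,1)}$; (ii) $\rho(\mathbb R^d)=1$; (iii) $\iint\left|\log\frac1{|x-y|}\right|\rho(dx)\rho(dy)<\infty$. For a nonnegative Radon measure $\mu$ with total mass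 $1$ and $\iint|\log\frac{1}{|x-y|}|\mu(dx)\mu(dy)<\infty$, the pairing $(h,\mu)$ is the $L^2(\mathbb P)$-limit of $(h,\mu*\psi_n)$, where $\psi_n(x)=n^d\psi(nx)$ and $\psi$ is smooth, nonnegative, symmetric, supported in $B(0,1)$, with integral $1$ (the limit exists and does not depend on $\psi$). For $\epsilon>0$, $z\in\mathbb R^d$, $\rho_{z,\epsilon}$ denotes the pushforward of $\rho$ under $y\mapsto z+\epsilon y$, and the mollified field is $h_\epsilon^\rho(z):=(h,\rho_{z,\epsilon})$. Condition $(A_p)$, for $p\in(0,1]$: there is a constant $C$ (which may depend on $\rho,p,d$) such that $$\mathbb E\big[(h_\epsilon^\rho(z)-h_r^\rho(w))^2\big]\le C\left(\frac{|(z,\epsilon)-(w,r)|}{\epsilon\wedge r}\right)^p$$ for all $z,w\in\mathbb R^d$ and all $\epsilon,r\in(0,1]$ with $\frac12\le\epsilon/r\le2$. Whenever $\rho$ satisfies Condition $(A_p)$, the process $(z,\epsilon)\mapsto h^\rho_\epsilon(z)$ on $\mathbb R^d\times(0,1]$ has a jointly continuous modification, and $h^\rho_\epsilon(z)$ denotes such a modification. *)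

theory Defs
  imports "HOL-Probability.Probability"
begin

text \<open>The space $\mathbb R^d$ is a type \<open>'a\<close> of class \<open>euclidean_space\<close>, with $d$ = \<open>DIM('a)\<close>.
  A multi-index is a list of basis vectors, in the order in which one differentiates
  (from the right).\<close>

fun partials :: "'a list \<Rightarrow> ('a::euclidean_space \<Rightarrow> real) \<Rightarrow> 'a \<Rightarrow> real" where
  "partials [] f = f"
| "partials (b # bs) f = (\<lambda>x. frechet_derivative (partials bs f) (at x) b)"

text \<open>Differentiability of every iterated partial derivative forces all of them to be continuous,
  so this is $C^\infty$.\<close>

definition smooth :: "('a::euclidean_space \<Rightarrow> real) \<Rightarrow> bool" where
  "smooth f \<longleftrightarrow> (\<forall>bs. set bs \<subseteq> Basis \<longrightarrow> partials bs f differentiable_on UNIV)"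

definition schwartz :: "('a::euclidean_space \<Rightarrow> real) set" where
  "schwartz = {f. smooth f \<and>
     (\<forall>bs k. set bs \<subseteq> Basis \<longrightarrow> bounded (range (\<lambda>x. (1 + norm x) ^ k * partials bs f x)))}"

definition schwartz0 :: "('a::euclidean_space \<Rightarrow> real) set" where
  "schwartz0 = {f \<in> schwartz. (LINT x|lborel. f x) = 0}"

definition schwartz_seminorm :: "nat \<Rightarrow> ('a::euclidean_space \<Rightarrow> real) \<Rightarrow> real" where
  "schwartz_seminorm N f =
     (SUP (bs, x) \<in> {bs. set bs \<subseteq> Basis \<and> length bs \<le> N} \<times> UNIV.
        (1 + norm x) ^ N * \<bar>partials bs f x\<bar>)"

text \<open>Continuous linear functionals on a linear subspace \<open>V\<close> of the Schwartz space, with its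
  Frechet topology; the seminorms are increasing in \<open>N\<close>, so one of them suffices for continuity.
  For \<open>V = schwartz\<close> these are the tempered distributions, for \<open>V = schwartz0\<close> the tempered
  distributions modulo additive constants.  Values outside \<open>V\<close> are irrelevant.\<close>

definition continuous_functional ::
    "('a::euclidean_space \<Rightarrow> real) set \<Rightarrow> (('a \<Rightarrow> real) \<Rightarrow> real) \<Rightarrow> bool" where
  "continuous_functional V T \<longleftrightarrow>
     (\<forall>f\<in>V. \<forall>g\<in>V. \<forall>a b. T (\<lambda>x. a * f x + b * g x) = a * T f + b * T g) \<and>
     (\<exists>N C. \<forall>f\<in>V. \<bar>T f\<bar> \<le> C * schwartz_seminorm N f)"

definition random_functional ::
    "'w measure \<Rightarrow> ('a::euclidean_space \<Rightarrow> real) set \<Rightarrow> ('w \<Rightarrow> ('a \<Rightarrow> real) \<Rightarrow> real) \<Rightarrow> bool" where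
  "random_functional M V h \<longleftrightarrow>
     (\<forall>\<omega>\<in>space M. continuous_functional V (h \<omega>)) \<and>
     (\<forall>f\<in>V. (\<lambda>\<omega>. h \<omega> f) \<in> borel_measurable M)"

text \<open>Variance \<open>0\<close> (the constant variable \<open>0\<close>) is allowed.\<close>

definition centered_gaussian :: "'w measure \<Rightarrow> ('w \<Rightarrow> real) \<Rightarrow> bool" where
  "centered_gaussian M X \<longleftrightarrow> X \<in> borel_measurable M \<and>
     (distr M borel X = return borel 0 \<or>
      (\<exists>s>0. distributed M lborel X (normal_density 0 s)))"

definition covariance :: "'w measure \<Rightarrow> ('w \<Rightarrow> real) \<Rightarrow> ('w \<Rightarrow> real) \<Rightarrow> real" where
  "covariance M X Y =
     (LINT \<omega>|M. (X \<omega> - (LINT \<omega>'|M. X \<omega>')) * (Y \<omega> - (LINT \<omega>'|M. Y \<omega>')))"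

text \<open>The field modulo additive constants.  Since each \<open>h \<omega>\<close> is linear, Gaussianity of the single
  pairings is joint Gaussianity.  The value \<open>ln (1 / 0) = 0\<close> on the diagonal is harmless here, as
  the diagonal is a Lebesgue null set.\<close>

definition LGF_mod_constants ::
    "'w measure \<Rightarrow> ('w \<Rightarrow> ('a::euclidean_space \<Rightarrow> real) \<Rightarrow> real) \<Rightarrow> bool" where
  "LGF_mod_constants M h \<longleftrightarrow>
     prob_space M \<and>
     random_functional M schwartz0 h \<and>
     (\<forall>f\<in>schwartz0. centered_gaussian M (\<lambda>\<omega>. h \<omega> f)) \<and>
     (\<forall>f\<^sub>1\<in>schwartz0. \<forall>f\<^sub>2\<in>schwartz0.
        covariance M (\<lambda>\<omega>. h \<omega> f\<^sub>1) (\<lambda>\<omega>. h \<omega> f\<^sub>2) =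
        (LINT (x, y)|(lborel \<Otimes>\<^sub>M lborel). ln (1 / norm (x - y)) * f\<^sub>1 x * f\<^sub>2 y))"

text \<open>The auxiliary bump functions $\psi$ and the pairing $(h,\mu)$ as the $L^2$-limit of
  $(h,\mu*\psi_n)$.  The limit is only determined up to null sets, so the pairing is a relation:
  \<open>Y\<close> is a version of $(h,\mu)$.\<close>

definition bump_kernel :: "('a::euclidean_space \<Rightarrow> real) \<Rightarrow> bool" where
  "bump_kernel \<psi> \<longleftrightarrow> smooth \<psi> \<and> (\<forall>x. 0 \<le> \<psi> x) \<and> (\<forall>x. \<psi> (- x) = \<psi> x) \<and>
     closure {x. \<psi> x \<noteq> 0} \<subseteq> ball 0 1 \<and> (LINT x|lborel. \<psi> x) = 1"

definition bump_scaled :: "('a::euclidean_space \<Rightarrow> real) \<Rightarrow> nat \<Rightarrow> 'a \<Rightarrow> real" where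
  "bump_scaled \<psi> n x = real n ^ DIM('a) * \<psi> (real n *\<^sub>R x)"

definition measure_convolution ::
    "'a::euclidean_space measure \<Rightarrow> ('a \<Rightarrow> real) \<Rightarrow> 'a \<Rightarrow> real" where
  "measure_convolution \<mu> g x = (LINT y|\<mu>. g (x - y))"

definition is_pairing ::
    "'w measure \<Rightarrow> ('a::euclidean_space \<Rightarrow> real) \<Rightarrow> ('w \<Rightarrow> ('a \<Rightarrow> real) \<Rightarrow> real) \<Rightarrow>
     'a measure \<Rightarrow> ('w \<Rightarrow> real) \<Rightarrow> bool" where
  "is_pairing M \<psi> h \<mu> Y \<longleftrightarrow> Y \<in> borel_measurable M \<and>
     (\<lambda>n. \<integral>\<^sup>+ \<omega>. ennreal ((h \<omega> (measure_convolution \<mu> (bump_scaled \<psi> n)) - Y \<omega>)\<^sup>2) \<partial>M)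
       \<longlonglongrightarrow> 0"

text \<open>Normalized surface measure on the unit sphere: by rotation invariance it is the law of
  \<open>x / norm x\<close> for \<open>x\<close> uniform in the unit ball.\<close>

definition unit_sphere_measure :: "'a::euclidean_space measure" where
  "unit_sphere_measure = distr (uniform_measure lborel (ball 0 1)) borel sgn"

text \<open>The field with its additive constant fixed: the representative, as a random tempered
  distribution, whose average over the unit sphere vanishes.\<close>

definition LGF ::
    "'w measure \<Rightarrow> ('a::euclidean_space \<Rightarrow> real) \<Rightarrow> ('w \<Rightarrow> ('a \<Rightarrow> real) \<Rightarrow> real) \<Rightarrow> bool" where
  "LGF M \<psi> h \<longleftrightarrow> LGF_mod_constants M h \<and> random_functional M schwartz h \<and>
     is_pairing M \<psi> h unit_sphere_measure (\<lambda>_. 0)"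

text \<open>$|\log(1/|x-y|)|$ takes the value $\infty$ on the diagonal, so that measures with atoms have
  infinite energy; \<open>ln (1 / 0) = 0\<close> would give the wrong value here.\<close>

definition abs_log_kernel :: "'a::euclidean_space \<Rightarrow> 'a \<Rightarrow> ennreal" where
  "abs_log_kernel x y = (if x = y then \<infinity> else ennreal \<bar>ln (1 / norm (x - y))\<bar>)"

definition measure_support :: "'a::topological_space measure \<Rightarrow> 'a set" where
  "measure_support \<mu> = {x. \<forall>V. open V \<longrightarrow> x \<in> V \<longrightarrow> emeasure \<mu> V > 0}"

text \<open>A Borel measure of total mass \<open>1\<close> on a Euclidean space is automatically Radon.\<close>

definition admissible_mollifier :: "'a::euclidean_space measure \<Rightarrow> bool" where
  "admissible_mollifier \<rho> \<longleftrightarrow> sets \<rho> = sets borel \<and>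
     measure_support \<rho> \<subseteq> closure (ball 0 1) \<and>
     emeasure \<rho> UNIV = 1 \<and>
     (\<integral>\<^sup>+ x. \<integral>\<^sup>+ y. abs_log_kernel x y \<partial>\<rho> \<partial>\<rho>) < \<infinity>"

definition rescaled :: "'a::euclidean_space measure \<Rightarrow> 'a \<Rightarrow> real \<Rightarrow> 'a measure" where
  "rescaled \<rho> z \<epsilon> = distr \<rho> borel (\<lambda>y. z + \<epsilon> *\<^sub>R y)"

text \<open>Condition $(A_p)$; \<open>Y\<close> and \<open>Y'\<close> are arbitrary versions of $h^\rho_\epsilon(z)$ and
  $h^\rho_r(w)$.  The norm is the Euclidean one on $\mathbb R^d\times\mathbb R$.\<close>

definition condition_A ::
    "'w measure \<Rightarrow> ('a::euclidean_space \<Rightarrow> real) \<Rightarrow> ('w \<Rightarrow> ('a \<Rightarrow> real) \<Rightarrow> real) \<Rightarrow>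
     real \<Rightarrow> 'a measure \<Rightarrow> bool" where
  "condition_A M \<psi> h p \<rho> \<longleftrightarrow>
     (\<exists>C::real. \<forall>z w. \<forall>\<epsilon>\<in>{0<..1}. \<forall>r\<in>{0<..1}. 1/2 \<le> \<epsilon> / r \<longrightarrow> \<epsilon> / r \<le> 2 \<longrightarrow>
        (\<forall>Y Y'. is_pairing M \<psi> h (rescaled \<rho> z \<epsilon>) Y \<longrightarrow> is_pairing M \<psi> h (rescaled \<rho> w r) Y' \<longrightarrow>
           (\<integral>\<^sup>+ \<omega>. ennreal ((Y \<omega> - Y' \<omega>)\<^sup>2) \<partial>M)
             \<le> ennreal (C * (norm ((z, \<epsilon>) - (w, r)) / min \<epsilon> r) powr p)))"

text \<open>\<open>H\<close> is a jointly continuous modification of $(z,\epsilon)\mapsto h^\rho_\epsilon(z)$ on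
  $\mathbb R^d\times(0,1]$.\<close>

definition mollified_field ::
    "'w measure \<Rightarrow> ('a::euclidean_space \<Rightarrow> real) \<Rightarrow> ('w \<Rightarrow> ('a \<Rightarrow> real) \<Rightarrow> real) \<Rightarrow>
     'a measure \<Rightarrow> ('a \<Rightarrow> real \<Rightarrow> 'w \<Rightarrow> real) \<Rightarrow> bool" where
  "mollified_field M \<psi> h \<rho> H \<longleftrightarrow>
     (\<forall>z. \<forall>\<epsilon>\<in>{0<..1}. is_pairing M \<psi> h (rescaled \<rho> z \<epsilon>) (H z \<epsilon>)) \<and>
     (\<forall>\<omega>\<in>space M. continuous_on (UNIV \<times> {0<..1}) (\<lambda>(z, \<epsilon>). H z \<epsilon> \<omega>))"

end

theory Submission
  imports Defs
begin

text \<open>The difference of the two rescaled mollifiers has total mass zero, so the logarithmic scale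
  factor cancels from its energy and the variance of \<open>X z \<epsilon>\<close> is bounded uniformly in \<open>z\<close> and \<open>\<epsilon>\<close>.
  By Condition $(A_p)$ the field at scale $2^{-n}$, with space and scale blown up by $2^n$, has
  Gaussian increments whose variance is controlled by a power of the distance, uniformly in \<open>n\<close>.
  There are only exponentially many (in \<open>n\<close>) dyadic points to control, while deviations of order
  \<open>n\<close> have probability $e^{-cn^2}$, so chaining and Borel--Cantelli give a supremum that is $o(n)$.\<close>

section \<open>Smooth functions and convolution\<close>

lemma partials_append: "partials (bs @ cs) f = partials bs (partials cs f)"
  by (induction bs) auto

lemma smooth_partials:
  assumes "smooth f" "set cs \<subseteq> Basis"
  shows "smooth (partials cs f)"
  using assms unfolding smooth_def
  by (metis (no_types, lifting) Un_subset_iff partials_append set_append)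

lemma smooth_partials_differentiable:
  assumes "smooth f" "set bs \<subseteq> Basis"
  shows "partials bs f differentiable at x"
  using assms unfolding smooth_def differentiable_on_def by auto

lemma smooth_differentiable: "smooth f \<Longrightarrow> f differentiable at x"
  using smooth_partials_differentiable[of f "[]"] by simp

lemma smooth_continuous_on: "smooth f \<Longrightarrow> continuous_on A f"
  by (meson continuous_at_imp_continuous_on differentiable_imp_continuous_within smooth_differentiable)

lemma smooth_borel_measurable: "smooth f \<Longrightarrow> f \<in> borel_measurable borel"
  by (intro borel_measurable_continuous_onI smooth_continuous_on)

lemma frechet_derivative_eq_sum_partials:
  assumes "smooth f"
  shows "frechet_derivative f (at x) v = (\<Sum>b\<in>Basis. (v \<bullet> b) * partials [b] f x)"
proof -
  have "linear (frechet_derivative f (at x))"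
    by (simp add: assms linear_frechet_derivative smooth_differentiable)
  then have "frechet_derivative f (at x) (\<Sum>b\<in>Basis. (v \<bullet> b) *\<^sub>R b)
      = (\<Sum>b\<in>Basis. (v \<bullet> b) * frechet_derivative f (at x) b)"
    by (simp add: linear_sum linear_scale)
  then show ?thesis by (simp add: euclidean_representation)
qed

lemma smooth_has_derivative:
  assumes "smooth f"
  shows "(f has_derivative (\<lambda>v. \<Sum>b\<in>Basis. (v \<bullet> b) * partials [b] f x)) (at x)"
  using frechet_derivative_works[of f "at x"] smooth_differentiable[OF assms]
  by (simp add: frechet_derivative_eq_sum_partials[OF assms, abs_def] del: partials.simps)

text \<open>The strict inequality describes an open set, so the derivative at one of its points sees
  only the zero function.\<close>

lemma partials_eq_0_outside:
  assumes "\<And>x. R < norm x \<Longrightarrow> f x = 0" "R < norm x"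
  shows "partials bs f x = 0"
  using assms(2)
proof (induction bs arbitrary: x)
  case Nil
  then show ?case using assms(1) by simp
next
  case (Cons b bs)
  have "((\<lambda>_. 0::real) has_derivative (\<lambda>_. 0)) (at x)" by simp
  then have "(partials bs f has_derivative (\<lambda>_. 0)) (at x)"
  proof (rule has_derivative_transform_within_open)
    show "open {x::'a. R < norm x}" by (intro open_Collect_less continuous_intros)
  qed (use Cons in auto)
  from fun_cong[OF frechet_derivative_at[OF this], of b] show ?case by simp
qed

lemma smooth_bounded_if_compact_support:
  assumes "smooth f" "\<And>x. R < norm x \<Longrightarrow> f x = 0"
  obtains B where "B \<ge> 0" "\<And>x. \<bar>f x\<bar> \<le> B"
proof -
  have "compact (f ` cball 0 R)"
    by (intro compact_continuous_image smooth_continuous_on assms compact_cball)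
  then obtain B where B: "\<And>y. y \<in> f ` cball 0 R \<Longrightarrow> norm y \<le> B"
    using compact_imp_bounded bounded_iff by metis
  \<comment> \<open>If \<open>R\<close> is negative, the ball is empty and \<open>B\<close> may be
    negative; hence the maximum with 0.\<close>
  show thesis
  proof (rule that[of "max B 0"])
    fix x show "\<bar>f x\<bar> \<le> max B 0"
      using B[of "f x"] assms(2)[of x] by (cases "R < norm x") auto
  qed auto
qed

lemma smooth_bounded_partials:
  assumes "smooth f" "\<And>x. R < norm x \<Longrightarrow> f x = 0" "set bs \<subseteq> Basis"
  obtains B where "B \<ge> 0" "\<And>x. \<bar>partials bs f x\<bar> \<le> B"
proof (rule smooth_bounded_if_compact_support[OF smooth_partials[OF assms(1,3)], of R])
  show "partials bs f x = 0" if "R < norm x" for x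
    using partials_eq_0_outside[OF assms(2) that] .
qed (use that in auto)

lemma smooth_lipschitz:
  assumes "smooth f" "\<And>x. R < norm x \<Longrightarrow> f x = 0"
  obtains L where "L \<ge> 0" "\<And>x y. \<bar>f x - f y\<bar> \<le> L * norm (x - y)"
proof -
  have "\<exists>B\<ge>0. \<forall>x. \<bar>partials [b] f x\<bar> \<le> B" if "b \<in> Basis" for b
    by (rule smooth_bounded_partials[of f R "[b]"]) (use assms that in \<open>auto simp del: partials.simps\<close>)
  then obtain B where B: "\<And>b. b \<in> Basis \<Longrightarrow> B b \<ge> 0" "\<And>b x. b \<in> Basis \<Longrightarrow> \<bar>partials [b] f x\<bar> \<le> B b"
    by metis
  show thesis
  proof (rule that[of "\<Sum>b\<in>Basis. B b"])
    fix x y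
    have "norm (f x - f y) \<le> (\<Sum>b\<in>Basis. B b) * norm (x - y)"
    proof (rule differentiable_bound[OF convex_UNIV smooth_has_derivative[OF assms(1)]])
      fix z
      show "onorm (\<lambda>v. \<Sum>b\<in>Basis. (v \<bullet> b) * partials [b] f z) \<le> (\<Sum>b\<in>Basis. B b)"
      proof (rule onorm_le)
        fix v
        have "norm (\<Sum>b\<in>Basis. (v \<bullet> b) * partials [b] f z) \<le> (\<Sum>b\<in>Basis. B b * norm v)"
          by (subst (2) mult.commute, intro sum_norm_le) (auto simp: abs_mult simp del: partials.simps intro!: mult_mono B Basis_le_norm)
        then show "norm (\<Sum>b\<in>Basis. (v \<bullet> b) * partials [b] f z) \<le> (\<Sum>b\<in>Basis. B b) * norm v"
          unfolding sum_distrib_right .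
      qed
    qed auto
    then show "\<bar>f x - f y\<bar> \<le> (\<Sum>b\<in>Basis. B b) * norm (x - y)" by simp
  qed (auto intro: sum_nonneg B)
qed

text \<open>The constant does not depend on the base point, so the remainder can later be integrated
  against a measure. It comes from the Lipschitz continuity of the first partials.\<close>

lemma smooth_taylor_bound:
  assumes "smooth f" "\<And>x. R < norm x \<Longrightarrow> f x = 0"
  obtains C where "C \<ge> 0"
    "\<And>x v. \<bar>f (x + v) - f x - (\<Sum>b\<in>Basis. (v \<bullet> b) * partials [b] f x)\<bar> \<le> C * (norm v)\<^sup>2"
proof -
  have "\<exists>L\<ge>0. \<forall>x y. \<bar>partials [b] f x - partials [b] f y\<bar> \<le> L * norm (x - y)" if "b \<in> Basis" for b
  proof (rule smooth_lipschitz[of "partials [b] f" R])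
    show "smooth (partials [b] f)" by (rule smooth_partials[OF assms(1)]) (use that in auto)
    show "partials [b] f x = 0" if "R < norm x" for x
      using partials_eq_0_outside[OF assms(2) that] .
  qed (use that in auto)
  then obtain L where L: "\<And>b. b \<in> Basis \<Longrightarrow> L b \<ge> 0"
     "\<And>b x y. b \<in> Basis \<Longrightarrow> \<bar>partials [b] f x - partials [b] f y\<bar> \<le> L b * norm (x - y)"
    by metis
  show thesis
  proof (rule that[of "\<Sum>b\<in>Basis. L b"])
    fix x v :: 'a
    let ?S = "cball x (norm v)"
    let ?D = "\<lambda>x v. \<Sum>b\<in>Basis. (v \<bullet> b) * partials [b] f x"
    \<comment> \<open>Mean value inequality for \<open>f\<close> minus its linearization at
      \<open>x\<close>. Across the ball of radius \<open>norm v\<close> the derivative varies by a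
      multiple of \<open>norm v\<close>, which gives the second factor.\<close>
    have "norm (f (x + v) - f x - ?D x ((x + v) - x)) \<le> norm ((x + v) - x) * ((\<Sum>b\<in>Basis. L b) * norm v)"
    proof (rule differentiable_bound_linearization[where S="?S"])
      fix t :: real assume "t \<in> {0..1}"
      then show "x + t *\<^sub>R (x + v - x) \<in> ?S"
        by (auto simp: dist_norm abs_mult mult_left_le_one_le)
    next
      fix z
      show "(f has_derivative ?D z) (at z within ?S)"
        using smooth_has_derivative[OF assms(1)] has_derivative_at_withinI by blast
    next
      fix z assume z: "z \<in> ?S"
      show "onorm (?D z - ?D x) \<le> (\<Sum>b\<in>Basis. L b) * norm v"
      proof (rule onorm_le)
        fix w
        have "(?D z - ?D x) w = (\<Sum>b\<in>Basis. (w \<bullet> b) * (partials [b] f z - partials [b] f x))"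
          by (simp add: algebra_simps sum_subtractf)
        also have "norm \<dots> \<le> (\<Sum>b\<in>Basis. norm w * (L b * norm v))"
        proof (intro sum_norm_le)
          fix b :: 'a assume b: "b \<in> Basis"
          have "\<bar>partials [b] f z - partials [b] f x\<bar> \<le> L b * norm v"
            by (rule order_trans[OF L(2)[OF b]], rule mult_left_mono)
              (use z L(1)[OF b] in \<open>auto simp: dist_norm norm_minus_commute\<close>)
          then show "norm (w \<bullet> b * (partials [b] f z - partials [b] f x)) \<le> norm w * (L b * norm v)"
            using b by (auto simp: abs_mult simp del: partials.simps intro!: mult_mono Basis_le_norm)
        qed
        finally show "norm ((?D z - ?D x) w) \<le> (\<Sum>b\<in>Basis. L b) * norm v * norm w"
          by (simp add: sum_distrib_left[symmetric] sum_distrib_right[symmetric] ac_simps)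
      qed
    qed auto
    then show "\<bar>f (x + v) - f x - ?D x v\<bar> \<le> (\<Sum>b\<in>Basis. L b) * (norm v)\<^sup>2"
      by (simp add: power2_eq_square ac_simps)
  qed (auto intro: sum_nonneg L)
qed

section \<open>Convolution of a smooth function with a probability measure\<close>

lemma integrable_measure_convolution:
  assumes "prob_space \<mu>" "sets \<mu> = sets borel" "smooth f" "\<And>x. R < norm x \<Longrightarrow> f x = 0"
  shows "integrable \<mu> (\<lambda>y. f (x - y))"
proof -
  interpret prob_space \<mu> by fact
  obtain B where B: "\<And>x. \<bar>f x\<bar> \<le> B" by (rule smooth_bounded_if_compact_support[OF assms(3,4)]; blast)
  have "(\<lambda>y. f (x - y)) \<in> borel_measurable borel"
    by (intro borel_measurable_continuous_onI continuous_on_compose2[OF smooth_continuous_on[OF assms(3)]]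
        continuous_intros) auto
  then have "(\<lambda>y. f (x - y)) \<in> borel_measurable \<mu>"
    using measurable_cong_sets[OF assms(2) refl] by blast
  then show ?thesis
    by (intro integrable_const_bound[where B=B]) (use B in auto)
qed

text \<open>The uniform quadratic remainder keeps its bound when integrated against a probability
  measure; divided by the length of the increment it still tends to 0. This takes the place of
  dominated convergence.\<close>

lemma measure_convolution_has_derivative:
  assumes "prob_space \<mu>" "sets \<mu> = sets borel" "smooth f" "\<And>x. R < norm x \<Longrightarrow> f x = 0"
  shows "(measure_convolution \<mu> f has_derivative
           (\<lambda>v. \<Sum>b\<in>Basis. (v \<bullet> b) * measure_convolution \<mu> (partials [b] f) x)) (at x)"
proof -
  interpret prob_space \<mu> by fact
  obtain C where C: "C \<ge> 0"
    "\<And>x v. \<bar>f (x + v) - f x - (\<Sum>b\<in>Basis. (v \<bullet> b) * partials [b] f x)\<bar> \<le> C * (norm v)\<^sup>2"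
    by (rule smooth_taylor_bound[OF assms(3,4)]; blast)
  have int: "integrable \<mu> (\<lambda>y. f (x - y))" for x
    by (rule integrable_measure_convolution[OF assms])
  have int': "integrable \<mu> (\<lambda>y. partials [b] f (x - y))" if "b \<in> Basis" for b x
    by (rule integrable_measure_convolution[OF assms(1,2) smooth_partials[OF assms(3)]
          partials_eq_0_outside[OF assms(4)]]) (use that in auto)
  let ?D = "\<lambda>v. \<Sum>b\<in>Basis. (v \<bullet> b) * measure_convolution \<mu> (partials [b] f) x"
  let ?g = "measure_convolution \<mu> f"
  have bound: "norm (?g (x + v) - ?g x - ?D v) \<le> C * (norm v)\<^sup>2" for v
  proof -
    have "?D v = (\<integral>y. (\<Sum>b\<in>Basis. (v \<bullet> b) * partials [b] f (x - y)) \<partial>\<mu>)"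
      unfolding measure_convolution_def using int' 
      by (subst Bochner_Integration.integral_sum) (auto simp del: partials.simps)
    then have eq: "?g (x + v) - ?g x - ?D v
        = (\<integral>y. f (x + v - y) - f (x - y) - (\<Sum>b\<in>Basis. (v \<bullet> b) * partials [b] f (x - y)) \<partial>\<mu>)"
      unfolding measure_convolution_def using int int'
      by (simp add: Bochner_Integration.integral_diff Bochner_Integration.integrable_diff
          Bochner_Integration.integrable_sum integrable_mult_right del: partials.simps)
    have "norm (?g (x + v) - ?g x - ?D v) \<le> (\<integral>y. norm (f (x + v - y) - f (x - y) - (\<Sum>b\<in>Basis. (v \<bullet> b) * partials [b] f (x - y))) \<partial>\<mu>)"
      unfolding eq by (rule integral_norm_bound)
    also have "\<dots> \<le> (\<integral>y. C * (norm v)\<^sup>2 \<partial>\<mu>)"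
    proof (rule integral_mono)
      fix y
      show "norm (f (x + v - y) - f (x - y) - (\<Sum>b\<in>Basis. (v \<bullet> b) * partials [b] f (x - y))) \<le> C * (norm v)\<^sup>2"
        using C(2)[of "x - y" v] by (simp add: algebra_simps)
    qed (use int int' in \<open>auto simp del: partials.simps\<close>)
    finally show ?thesis by (simp add: prob_space)
  qed
  show ?thesis
  proof (rule has_derivativeI_sandwich[of 1])
    show "bounded_linear ?D" by (intro bounded_linear_sum bounded_linear_mult_left bounded_linear_inner_left
          bounded_linear_compose[OF bounded_linear_mult_left])
    fix y
    show "norm (?g y - ?g x - ?D (y - x)) / norm (y - x) \<le> C * norm (y - x)"
      using bound[of "y - x"] by (cases "y = x") (auto simp: field_simps power2_eq_square)
    show "((\<lambda>y. C * norm (y - x)) \<longlongrightarrow> 0) (at x)"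
      by (rule tendsto_eq_intros refl)+ auto
  qed auto
qed

lemma partials_measure_convolution:
  assumes "prob_space \<mu>" "sets \<mu> = sets borel" "smooth f" "\<And>x. R < norm x \<Longrightarrow> f x = 0"
    and "set bs \<subseteq> Basis"
  shows "partials bs (measure_convolution \<mu> f) = measure_convolution \<mu> (partials bs f)"
  using assms(5)
proof (induction bs)
  case (Cons b bs)
  let ?g = "partials bs f"
  have b: "b \<in> Basis" and sm: "smooth ?g" using Cons.prems smooth_partials[OF assms(3)] by auto
  have "partials (b # bs) (measure_convolution \<mu> f) x = measure_convolution \<mu> (partials (b # bs) f) x" for x
  proof -
    have "(measure_convolution \<mu> ?g has_derivative
           (\<lambda>v. \<Sum>c\<in>Basis. (v \<bullet> c) * measure_convolution \<mu> (partials [c] ?g) x)) (at x)"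
      by (rule measure_convolution_has_derivative[OF assms(1,2) sm partials_eq_0_outside[OF assms(4)]]) auto
    from fun_cong[OF frechet_derivative_at[OF this], of b]
    have "partials (b # bs) (measure_convolution \<mu> f) x = (\<Sum>c\<in>Basis. (b \<bullet> c) * measure_convolution \<mu> (partials [c] ?g) x)"
      using Cons by simp
    \<comment> \<open>Orthonormality of the basis leaves only the summand
      \<open>c = b\<close>.\<close>
    also have "\<dots> = measure_convolution \<mu> (partials [b] ?g) x"
      using b by (subst sum.remove[OF _ b]) (auto simp: inner_Basis simp del: partials.simps intro!: sum.neutral split: if_splits)
    finally show ?thesis by simp
  qed
  then show ?case by blast
qed simp

lemma smooth_measure_convolution:
  assumes "prob_space \<mu>" "sets \<mu> = sets borel" "smooth f" "\<And>x. R < norm x \<Longrightarrow> f x = 0"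
  shows "smooth (measure_convolution \<mu> f)"
  unfolding smooth_def differentiable_on_def
proof safe
  fix bs :: "'a list" and x assume bs: "set bs \<subseteq> Basis"
  show "partials bs (measure_convolution \<mu> f) differentiable at x"
    unfolding differentiable_def partials_measure_convolution[where R=R, OF assms bs, simplified]
    by (rule exI, rule measure_convolution_has_derivative[where R=R])
      (use assms smooth_partials[OF assms(3) bs] partials_eq_0_outside[OF assms(4)] in auto)
qed

lemma smooth_compact_support_schwartz:
  assumes "smooth f" "\<And>x. R < norm x \<Longrightarrow> f x = 0"
  shows "f \<in> schwartz"
  unfolding schwartz_def
proof safe
  fix bs :: "'a list" and k :: nat assume bs: "set bs \<subseteq> Basis"
  obtain B where B: "B \<ge> 0" "\<And>x. \<bar>partials bs f x\<bar> \<le> B" by (rule smooth_bounded_partials[OF assms bs]; blast)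
  show "bounded (range (\<lambda>x. (1 + norm x) ^ k * partials bs f x))"
  proof (rule boundedI[of _ "(1 + \<bar>R\<bar>) ^ k * B"], clarify)
    fix x
    show "norm ((1 + norm x) ^ k * partials bs f x) \<le> (1 + \<bar>R\<bar>) ^ k * B"
    proof (cases "R < norm x")
      case True
      then show ?thesis using partials_eq_0_outside[OF assms(2) True] B by simp
    next
      case False
      then show ?thesis using B by (auto simp: abs_mult intro!: mult_mono power_mono)
    qed
  qed
qed fact

section \<open>Scaling and linear combinations of smooth functions\<close>

lemma partials_scaled:
  assumes "smooth f" "set bs \<subseteq> Basis"
  shows "partials bs (\<lambda>x. c * f (a *\<^sub>R x)) = (\<lambda>x. (c * a ^ length bs) * partials bs f (a *\<^sub>R x))"
  using assms(2)
proof (induction bs)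
  case (Cons b bs)
  let ?g = "partials bs f"
  have sm: "smooth ?g" using Cons.prems smooth_partials[OF assms(1)] by auto
  show ?case
  proof
    fix x
    have "((\<lambda>x. (c * a ^ length bs) * ?g (a *\<^sub>R x)) has_derivative
          (\<lambda>v. (c * a ^ length bs) * frechet_derivative ?g (at (a *\<^sub>R x)) (a *\<^sub>R v))) (at x)"
      by (intro derivative_intros has_derivative_compose[where f="\<lambda>x. a *\<^sub>R x" and g="?g"])
        (use frechet_derivative_works smooth_differentiable[OF sm] in blast)
    from fun_cong[OF frechet_derivative_at[OF this, symmetric], of b]
    have "partials (b # bs) (\<lambda>x. c * f (a *\<^sub>R x)) x
        = (c * a ^ length bs) * frechet_derivative ?g (at (a *\<^sub>R x)) (a *\<^sub>R b)"
      using Cons by simp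
    moreover have "frechet_derivative ?g (at (a *\<^sub>R x)) (a *\<^sub>R b) = a * frechet_derivative ?g (at (a *\<^sub>R x)) b"
      using linear_scale[OF linear_frechet_derivative[OF smooth_differentiable[OF sm]]] by simp
    ultimately show "partials (b # bs) (\<lambda>x. c * f (a *\<^sub>R x)) x
        = (c * a ^ length (b # bs)) * partials (b # bs) f (a *\<^sub>R x)"
      by (simp add: ac_simps)
  qed
qed simp

lemma smooth_scaled:
  assumes "smooth f"
  shows "smooth (\<lambda>x. c * f (a *\<^sub>R x))"
  unfolding smooth_def
proof safe
  fix bs :: "'a list" assume bs: "set bs \<subseteq> Basis"
  have "(\<lambda>x. partials bs f (a *\<^sub>R x)) differentiable at x" for x
    using differentiable_chain_at[of "\<lambda>x. a *\<^sub>R x" x "partials bs f"] smooth_partials_differentiable[OF assms bs]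
    by (auto simp: o_def)
  then show "partials bs (\<lambda>x. c * f (a *\<^sub>R x)) differentiable_on UNIV"
    unfolding partials_scaled[OF assms bs] differentiable_on_def by (auto intro!: derivative_intros)
qed

lemma partials_linear_combination:
  assumes "smooth f" "smooth g" "set bs \<subseteq> Basis"
  shows "partials bs (\<lambda>x. a * f x + b * g x) = (\<lambda>x. a * partials bs f x + b * partials bs g x)"
  using assms(3)
proof (induction bs)
  case (Cons c bs)
  have sm: "smooth (partials bs f)" "smooth (partials bs g)"
    using Cons.prems smooth_partials assms by auto
  show ?case
  proof
    fix x
    have "((\<lambda>x. a * partials bs f x + b * partials bs g x) has_derivative
       (\<lambda>v. a * frechet_derivative (partials bs f) (at x) v + b * frechet_derivative (partials bs g) (at x) v)) (at x)"
      by (intro has_derivative_add has_derivative_mult_right)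
        (use frechet_derivative_works smooth_differentiable sm in blast)+
    from fun_cong[OF frechet_derivative_at[OF this, symmetric], of c]
    show "partials (c # bs) (\<lambda>x. a * f x + b * g x) x = a * partials (c # bs) f x + b * partials (c # bs) g x"
      using Cons by simp
  qed
qed simp

lemma smooth_linear_combination:
  assumes "smooth f" "smooth g"
  shows "smooth (\<lambda>x. a * f x + b * g x)"
  unfolding smooth_def
proof safe
  fix bs :: "'a list" assume bs: "set bs \<subseteq> Basis"
  show "partials bs (\<lambda>x. a * f x + b * g x) differentiable_on UNIV"
    unfolding partials_linear_combination[OF assms bs] differentiable_on_def
    using smooth_partials_differentiable[OF assms(1) bs] smooth_partials_differentiable[OF assms(2) bs]
    by (auto intro!: derivative_intros)
qed

lemma smooth_diff: "smooth f \<Longrightarrow> smooth g \<Longrightarrow> smooth (\<lambda>x. f x - g x)"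
  using smooth_linear_combination[of f g 1 "-1"] by simp

section \<open>The logarithmic energy of mollifier differences\<close>

text \<open>Dyadic balls replace polar coordinates. Where the distance to \<open>y\<close> is about
  \<open>r / 2 ^ k\<close> the integrand is at most \<open>2 ^ Suc k / r\<close>, and the ball of
  that radius has volume of order \<open>(r / 2 ^ k) ^ d\<close>. One factor 2 of the constant comes
  from the width of a shell, the other from the geometric series.\<close>

lemma nn_integral_inverse_norm_ball:
  fixes y :: "'a::euclidean_space"
  assumes d: "DIM('a) \<ge> 2" and r: "0 < r"
  shows "(\<integral>\<^sup>+x. ennreal (1 / norm (x - y)) * indicator (ball y r) x \<partial>lborel)
    \<le> ennreal (4 * unit_ball_vol DIM('a) * r ^ (DIM('a) - 1))"
proof -
  let ?d = "DIM('a)"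
  let ?V = "unit_ball_vol ?d"
  let ?g = "\<lambda>k x. ennreal (2 ^ Suc k / r) * indicator (ball y (r / 2 ^ k)) x"
  have [measurable]: "ball y s \<in> sets borel" for s by simp
  \<comment> \<open>At \<open>x = y\<close> the left-hand side is 0, because
    \<open>1 / 0 = 0\<close>.\<close>
  have pw: "ennreal (1 / norm (x - y)) * indicator (ball y r) x \<le> (\<Sum>k. ?g k x)" for x
  proof (cases "x \<in> ball y r \<and> x \<noteq> y")
    case True
    then have x: "0 < norm (x - y)" "norm (x - y) < r" by (auto simp: dist_norm norm_minus_commute)
    have ex: "\<exists>k. r / 2 ^ Suc k \<le> norm (x - y)"
    proof -
      obtain k where "r / norm (x - y) < 2 ^ k" using real_arch_pow[of 2 "r / norm (x - y)"] by auto
      then have "r / 2 ^ k \<le> norm (x - y)" using x r by (simp add: field_simps)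
      moreover have "r / 2 ^ Suc k \<le> r / 2 ^ k" using r by (simp add: field_simps)
      ultimately show ?thesis by (meson order_trans)
    qed
    \<comment> \<open>The index of the shell that contains \<open>x\<close>: minimality gives the
      upper bound on the distance.\<close>
    define k where "k = (LEAST k. r / 2 ^ Suc k \<le> norm (x - y))"
    have k1: "r / 2 ^ Suc k \<le> norm (x - y)" unfolding k_def by (rule LeastI_ex[OF ex])
    have k2: "norm (x - y) < r / 2 ^ k"
    proof (cases k)
      case (Suc j)
      then have "\<not> r / 2 ^ Suc j \<le> norm (x - y)" unfolding k_def by (intro not_less_Least) auto
      then show ?thesis using Suc by simp
    qed (use x in auto)
    have "1 / norm (x - y) \<le> 2 ^ Suc k / r" using k1 x r by (simp add: field_simps)
    then have "ennreal (1 / norm (x - y)) * indicator (ball y r) x \<le> ?g k x"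
      using True k2 by (auto simp: dist_norm norm_minus_commute intro!: ennreal_leI)
    also have "?g k x = (\<Sum>j\<in>{k}. ?g j x)"
      by (simp only: finite.emptyI sum.insert empty_iff not_False_eq_True sum.empty add_0_right)
    also have "\<dots> \<le> (\<Sum>k. ?g k x)"
      by (rule sum_le_suminf) auto
    finally show ?thesis .
  qed auto
  have term_le: "(\<integral>\<^sup>+x. ?g k x \<partial>lborel) \<le> ennreal (2 * ?V * r ^ (?d - 1) * (1/2) ^ k)" for k
  proof -
    have "(\<integral>\<^sup>+x. ?g k x \<partial>lborel) = ennreal (2 ^ Suc k / r) * ennreal (?V * (r / 2 ^ k) ^ ?d)"
      using r by (subst nn_integral_cmult_indicator) (auto simp: emeasure_ball)
    also have "\<dots> = ennreal (2 ^ Suc k / r * (?V * (r / 2 ^ k) ^ ?d))"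
      using r by (subst ennreal_mult) auto
    also have "\<dots> \<le> ennreal (2 * ?V * r ^ (?d - 1) * (1/2) ^ k)"
    proof (rule ennreal_leI)
      \<comment> \<open>With exponent 2 in place of the dimension, the volume gains
        \<open>1 / 4 ^ k\<close> against the growth \<open>2 ^ k\<close> of the integrand, so the
        terms still decay like \<open>(1/2) ^ k\<close>.\<close>
      have "((2::real) ^ k) ^ 2 \<le> (2 ^ k) ^ ?d" using d by (intro power_increasing) auto
      then have "r ^ ?d / (2 ^ k) ^ ?d \<le> r ^ ?d / (2 ^ k) ^ 2" using r by (intro divide_left_mono) auto
      then have "(r / 2 ^ k) ^ ?d \<le> r ^ ?d / (2 ^ k) ^ 2" by (simp add: power_divide)
      then have "2 ^ Suc k / r * (?V * (r / 2 ^ k) ^ ?d) \<le> 2 ^ Suc k / r * (?V * (r ^ ?d / (2 ^ k) ^ 2))"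
        using r by (intro mult_left_mono) auto
      also have "r ^ ?d = r * r ^ (?d - 1)" using d by (metis One_nat_def DIM_positive Suc_pred power_Suc)
      then have "2 ^ Suc k / r * (?V * (r ^ ?d / (2 ^ k) ^ 2)) = 2 * ?V * r ^ (?d - 1) * (1/2) ^ k"
        using r by (simp add: field_simps power2_eq_square power_one_over)
      finally show "2 ^ Suc k / r * (?V * (r / 2 ^ k) ^ ?d) \<le> 2 * ?V * r ^ (?d - 1) * (1/2) ^ k" .
    qed
    finally show ?thesis .
  qed
  have "(\<integral>\<^sup>+x. ennreal (1 / norm (x - y)) * indicator (ball y r) x \<partial>lborel) \<le> (\<integral>\<^sup>+x. (\<Sum>k. ?g k x) \<partial>lborel)"
    by (intro nn_integral_mono pw)
  also have "\<dots> = (\<Sum>k. \<integral>\<^sup>+x. ?g k x \<partial>lborel)"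
    by (intro nn_integral_suminf) measurable
  also have "\<dots> \<le> (\<Sum>k. ennreal (2 * ?V * r ^ (?d - 1) * (1/2) ^ k))"
    by (intro suminf_le term_le) auto
  also have "\<dots> = ennreal (2 * ?V * r ^ (?d - 1) * 2)"
  proof (intro suminf_ennreal_eq)
    show "(\<lambda>k. 2 * ?V * r ^ (?d - 1) * (1/2) ^ k) sums (2 * ?V * r ^ (?d - 1) * 2)"
      using geometric_sums[of "1/2::real"] by (intro sums_mult) auto
  qed (use r in auto)
  finally show ?thesis by (simp add: ac_simps)
qed

section \<open>Scaled bump functions\<close>

lemma smooth_bump_scaled: "bump_kernel \<psi> \<Longrightarrow> smooth (bump_scaled \<psi> n)"
  unfolding bump_scaled_def[abs_def] bump_kernel_def by (intro smooth_scaled) auto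

lemma bump_scaled_nonneg: "bump_kernel \<psi> \<Longrightarrow> 0 \<le> bump_scaled \<psi> n x"
  by (auto simp: bump_scaled_def bump_kernel_def)

lemma bump_scaled_eq_0:
  assumes "bump_kernel \<psi>" "0 < n" "1 / real n \<le> norm x"
  shows "bump_scaled \<psi> n x = 0"
proof -
  have "\<psi> w = 0" if "1 \<le> norm w" for w
  proof (rule ccontr)
    assume "\<psi> w \<noteq> 0"
    then have "w \<in> closure {x. \<psi> x \<noteq> 0}" using closure_subset[of "{x. \<psi> x \<noteq> 0}"] by auto
    then show False using assms(1) that by (auto simp: bump_kernel_def)
  qed
  then show ?thesis using assms by (simp add: bump_scaled_def field_simps)
qed

text \<open>A radius free of \<open>n\<close>, with the strict inequality that the convolution
  lemmas expect.\<close>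

lemma bump_scaled_eq_0':
  assumes "bump_kernel \<psi>" "0 < n" "1 < norm x"
  shows "bump_scaled \<psi> n x = 0"
proof (rule bump_scaled_eq_0[OF assms(1,2)])
  have "1 / real n \<le> 1" using assms(2) by simp
  then show "1 / real n \<le> norm x" using assms(3) by linarith
qed

lemma bump_scaled_measurable [measurable]:
  "bump_kernel \<psi> \<Longrightarrow> bump_scaled \<psi> n \<in> borel_measurable borel"
  by (intro smooth_borel_measurable smooth_bump_scaled)

lemma nn_integral_bump_scaled:
  fixes \<psi> :: "'a::euclidean_space \<Rightarrow> real"
  assumes \<psi>: "bump_kernel \<psi>" and n: "0 < n"
  shows "(\<integral>\<^sup>+x. ennreal (bump_scaled \<psi> n (x - u)) \<partial>lborel) = 1"
proof -
  have [measurable]: "\<psi> \<in> borel_measurable borel"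
    using \<psi> smooth_borel_measurable by (auto simp: bump_kernel_def)
  note bump_scaled_measurable[OF \<psi>, measurable]
  \<comment> \<open>A Bochner integral equal to 1 is not the default value 0 of a non-integrable
    function.\<close>
  have "integrable lborel \<psi>" using \<psi> not_integrable_integral_eq by (fastforce simp: bump_kernel_def)
  then have 1: "(\<integral>\<^sup>+x. ennreal (\<psi> x) \<partial>lborel) = 1"
    using \<psi> by (subst nn_integral_eq_integral) (auto simp: bump_kernel_def)
  have "(\<integral>\<^sup>+x. ennreal (bump_scaled \<psi> n (x - u)) \<partial>lborel)
    = (\<integral>\<^sup>+x. ennreal (\<bar>1 / real n\<bar> ^ DIM('a)) * ennreal (bump_scaled \<psi> n (u + (1 / real n) *\<^sub>R x - u)) \<partial>lborel)"
    using n by (subst lborel_affine[where c="1 / real n" and t=u])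
      (auto simp: nn_integral_density nn_integral_distr)
  also have "\<dots> = (\<integral>\<^sup>+x. ennreal (\<psi> x) \<partial>lborel)"
    using n by (intro nn_integral_cong) (simp add: bump_scaled_def ennreal_mult'[symmetric] power_one_over)
  finally show ?thesis using 1 by simp
qed

text \<open>This averages the error of \<open>log_kernel_smear_bound\<close> over one bump. At
  distance at least \<open>1 / n\<close> from \<open>y\<close> the weight is at most 2 and the bump
  has mass 1. Closer to \<open>y\<close> the bump is at most a multiple of \<open>n ^ d\<close>, and
  the integral over the ball of radius \<open>1 / n\<close> supplies exactly the missing power of
  \<open>n\<close>.\<close>

lemma nn_integral_inverse_norm_bump:
  fixes \<psi> :: "'a::euclidean_space \<Rightarrow> real"
  assumes \<psi>: "bump_kernel \<psi>" and d: "DIM('a) \<ge> 2"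
  obtains C where "0 \<le> C" "\<And>n u y. 0 < n \<Longrightarrow>
    (\<integral>\<^sup>+x. ennreal (2 / (real n * norm (x - y))) * ennreal (bump_scaled \<psi> n (x - u)) \<partial>lborel) \<le> ennreal C"
proof -
  note bump_scaled_measurable[OF \<psi>, measurable]
  have "smooth \<psi>" "\<And>x. 1 < norm x \<Longrightarrow> \<psi> x = 0"
    using \<psi> bump_scaled_eq_0'[OF \<psi>, of 1] by (auto simp: bump_kernel_def bump_scaled_def)
  then obtain B where B: "B \<ge> 0" "\<And>x. \<bar>\<psi> x\<bar> \<le> B"
    by (rule smooth_bounded_if_compact_support; blast)
  let ?d = "DIM('a)"
  let ?V = "unit_ball_vol ?d"
  show thesis
  proof (rule that[of "2 + 8 * B * ?V"])
    fix n :: nat and u y :: 'a assume n: "0 < n"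
    let ?c = "2 / n * real n ^ ?d * B"
    have pw: "ennreal (2 / (real n * norm (x - y))) * ennreal (bump_scaled \<psi> n (x - u))
      \<le> 2 * ennreal (bump_scaled \<psi> n (x - u)) + ennreal ?c * (ennreal (1 / norm (x - y)) * indicator (ball y (1 / n)) x)" for x
    proof (cases "x \<in> ball y (1 / n)")
      case True
      have "2 / (real n * norm (x - y)) * bump_scaled \<psi> n (x - u) \<le> 2 / (real n * norm (x - y)) * (real n ^ ?d * B)"
        using B unfolding bump_scaled_def by (intro mult_left_mono) (auto simp: abs_le_iff)
      also have "\<dots> = ?c * (1 / norm (x - y))" by simp
      finally have "ennreal (2 / (real n * norm (x - y)) * bump_scaled \<psi> n (x - u)) \<le> ennreal (?c * (1 / norm (x - y)))"
        by (rule ennreal_leI)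
      then have "ennreal (2 / (real n * norm (x - y))) * ennreal (bump_scaled \<psi> n (x - u))
          \<le> ennreal ?c * ennreal (1 / norm (x - y))"
        using B by (subst (1 2) ennreal_mult[symmetric]) (auto simp: bump_scaled_nonneg[OF \<psi>])
      then show ?thesis using True by (simp only: indicator_simps mult_1_right) (rule add_increasing, auto)
    next
      case False
      then have "1 / n \<le> norm (x - y)" by (simp add: dist_norm norm_minus_commute)
      moreover have "0 < norm (x - y)" using calculation n by (meson less_le_trans of_nat_0_less_iff zero_less_divide_1_iff)
      ultimately have "2 / (real n * norm (x - y)) \<le> 2" using n by (simp add: field_simps)
      then have "ennreal (2 / (real n * norm (x - y))) \<le> 2" by (metis ennreal_leI ennreal_numeral zero_le_numeral)
      then show ?thesis using False by (auto intro: mult_right_mono)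
    qed
    have "(\<integral>\<^sup>+x. ennreal (2 / (real n * norm (x - y))) * ennreal (bump_scaled \<psi> n (x - u)) \<partial>lborel)
      \<le> (\<integral>\<^sup>+x. 2 * ennreal (bump_scaled \<psi> n (x - u)) + ennreal ?c * (ennreal (1 / norm (x - y)) * indicator (ball y (1 / n)) x) \<partial>lborel)"
      by (intro nn_integral_mono pw)
    also have "\<dots> = 2 * (\<integral>\<^sup>+x. ennreal (bump_scaled \<psi> n (x - u)) \<partial>lborel) +
       ennreal ?c * (\<integral>\<^sup>+x. ennreal (1 / norm (x - y)) * indicator (ball y (1 / n)) x \<partial>lborel)"
    proof -
      have [measurable]: "ball y (1 / n) \<in> sets borel" by simp
      have [measurable]: "(\<lambda>x. ennreal (1 / norm (x - y)) * indicator (ball y (1 / n)) x) \<in> borel_measurable borel"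
        by measurable
      show ?thesis by (subst nn_integral_add; (subst nn_integral_cmult)?; simp add: nn_integral_cmult)
    qed
    also have "\<dots> \<le> 2 * 1 + ennreal ?c * ennreal (4 * ?V * (1 / n) ^ (?d - 1))"
      using nn_integral_inverse_norm_ball[OF d, of "1/n" y] n
      by (intro add_mono mult_left_mono) (auto simp: nn_integral_bump_scaled[OF \<psi> n])
    also have "ennreal ?c * ennreal (4 * ?V * (1 / n) ^ (?d - 1)) = ennreal (?c * (4 * ?V * (1 / n) ^ (?d - 1)))"
      by (rule ennreal_mult[symmetric]) (use B in auto)
    also have "2 * 1 + ennreal (?c * (4 * ?V * (1 / n) ^ (?d - 1))) = ennreal (2 + ?c * (4 * ?V * (1 / n) ^ (?d - 1)))"
      using B by (subst ennreal_plus) auto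
    also have "?c * (4 * ?V * (1 / n) ^ (?d - 1)) = 8 * B * ?V"
    proof -
      have "real n ^ ?d = n * real n ^ (?d - 1)" using d by (metis One_nat_def DIM_positive Suc_pred power_Suc)
      then show ?thesis using n by (simp add: power_one_over)
    qed
    finally show "(\<integral>\<^sup>+x. ennreal (2 / (real n * norm (x - y))) * ennreal (bump_scaled \<psi> n (x - u)) \<partial>lborel)
      \<le> ennreal (2 + 8 * B * ?V)" .
  qed (use B in auto)
qed

section \<open>Measures smeared by a bump\<close>

lemma ennreal_measure_convolution:
  assumes \<psi>: "bump_kernel \<psi>" and n: "0 < n" and \<mu>: "prob_space \<mu>" "sets \<mu> = sets borel"
  shows "ennreal (measure_convolution \<mu> (bump_scaled \<psi> n) x) = (\<integral>\<^sup>+u. ennreal (bump_scaled \<psi> n (x - u)) \<partial>\<mu>)"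
  unfolding measure_convolution_def
  by (rule nn_integral_eq_integral[symmetric], rule integrable_measure_convolution[where R=1])
    (simp_all add: assms bump_scaled_nonneg[OF \<psi>] bump_scaled_eq_0'[OF \<psi> n] smooth_bump_scaled[OF \<psi>])

lemma measure_convolution_nonneg:
  "bump_kernel \<psi> \<Longrightarrow> 0 \<le> measure_convolution \<mu> (bump_scaled \<psi> n) x"
  unfolding measure_convolution_def by (simp add: bump_scaled_nonneg)

text \<open>Tonelli, with a free nonnegative weight \<open>G\<close> so that it can be applied once
  in each variable of the energy.\<close>

lemma nn_integral_measure_convolution:
  assumes \<psi>: "bump_kernel \<psi>" and n: "0 < n" and \<mu>: "prob_space \<mu>" "sets \<mu> = sets borel"
    and [measurable]: "G \<in> borel_measurable borel"
  shows "(\<integral>\<^sup>+x. G x * ennreal (measure_convolution \<mu> (bump_scaled \<psi> n) x) \<partial>lborel)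
    = (\<integral>\<^sup>+u. (\<integral>\<^sup>+x. G x * ennreal (bump_scaled \<psi> n (x - u)) \<partial>lborel) \<partial>\<mu>)"
proof -
  interpret \<mu>: prob_space \<mu> by fact
  interpret pair_sigma_finite lborel \<mu> by unfold_locales
  note \<mu>(2)[measurable_cong] bump_scaled_measurable[OF \<psi>, measurable]
  have "(\<integral>\<^sup>+x. G x * ennreal (measure_convolution \<mu> (bump_scaled \<psi> n) x) \<partial>lborel)
    = (\<integral>\<^sup>+x. (\<integral>\<^sup>+u. G x * ennreal (bump_scaled \<psi> n (x - u)) \<partial>\<mu>) \<partial>lborel)"
    by (intro nn_integral_cong) (simp add: ennreal_measure_convolution[OF \<psi> n \<mu>] nn_integral_cmult)
  also have "\<dots> = (\<integral>\<^sup>+u. (\<integral>\<^sup>+x. G x * ennreal (bump_scaled \<psi> n (x - u)) \<partial>lborel) \<partial>\<mu>)"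
    by (rule Fubini'[symmetric]) measurable
  finally show ?thesis .
qed

lemma measure_convolution_bump:
  assumes \<psi>: "bump_kernel \<psi>" and n: "0 < n" and \<mu>: "prob_space \<mu>" "sets \<mu> = sets borel"
  shows "smooth (measure_convolution \<mu> (bump_scaled \<psi> n))"
    and "integrable lborel (measure_convolution \<mu> (bump_scaled \<psi> n))"
    and "(LINT x|lborel. measure_convolution \<mu> (bump_scaled \<psi> n) x) = 1"
proof -
  let ?f = "measure_convolution \<mu> (bump_scaled \<psi> n)"
  interpret \<mu>: prob_space \<mu> by fact
  show sm: "smooth ?f"
    by (rule smooth_measure_convolution[where R=1])
      (use assms bump_scaled_eq_0' smooth_bump_scaled in auto)
  note smooth_borel_measurable[OF sm, measurable]
  have I: "(\<integral>\<^sup>+x. ennreal (?f x) \<partial>lborel) = ennreal 1"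
    using nn_integral_measure_convolution[OF assms, of "\<lambda>_. 1"] nn_integral_bump_scaled[OF \<psi> n]
      \<mu>.emeasure_space_1 by simp
  then show "integrable lborel ?f"
    by (intro integrableI_nonneg) (auto simp: measure_convolution_nonneg[OF \<psi>])
  show "(LINT x|lborel. ?f x) = 1"
    using I by (subst integral_eq_nn_integral) (auto simp: measure_convolution_nonneg[OF \<psi>])
qed

text \<open>By second countability the complement of the support is covered by countably many basic
  open sets of measure zero.\<close>

lemma AE_measure_support:
  fixes \<mu> :: "'a::second_countable_topology measure"
  assumes "sets \<mu> = sets borel"
  shows "AE x in \<mu>. x \<in> measure_support \<mu>"
proof -
  obtain \<B> :: "'a set set" where \<B>: "countable \<B>" "topological_basis \<B>" using ex_countable_basis by auto
  let ?N = "\<Union>{B \<in> \<B>. emeasure \<mu> B = 0}"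
  have null: "?N \<in> null_sets \<mu>"
  proof (rule null_sets_UN'[of _ "\<lambda>x. x", simplified])
    show "countable {B \<in> \<B>. emeasure \<mu> B = 0}" using \<B>(1) by simp
    show "B \<in> null_sets \<mu>" if "B \<in> {B \<in> \<B>. emeasure \<mu> B = 0}" for B
      using that topological_basis_open[OF \<B>(2)] assms by auto
  qed
  have "x \<in> ?N" if x: "x \<notin> measure_support \<mu>" for x
  proof -
    obtain V where V: "open V" "x \<in> V" "emeasure \<mu> V = 0"
      using x by (auto simp: measure_support_def)
    obtain B where B: "B \<in> \<B>" "x \<in> B" "B \<subseteq> V" using topological_basisE[OF \<B>(2) V(1,2)] .
    have "emeasure \<mu> B \<le> emeasure \<mu> V" using B V assms by (intro emeasure_mono) auto
    then show ?thesis using B V by auto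
  qed
  then show ?thesis by (intro AE_I'[OF null]) auto
qed

lemma abs_log_kernel_measurable [measurable]:
  "(\<lambda>(x, y). abs_log_kernel (x::'a::euclidean_space) y) \<in> borel_measurable (borel \<Otimes>\<^sub>M borel)"
proof -
  have "(\<lambda>(x::'a, y). abs_log_kernel x y) = (\<lambda>(x, y). if norm (x - y) = 0 then \<infinity> else ennreal \<bar>ln (1 / norm (x - y))\<bar>)"
    by (auto simp: abs_log_kernel_def fun_eq_iff)
  then show ?thesis by simp
qed

text \<open>By the triangle inequality \<open>\<epsilon> * norm (v - u)\<close> exceeds
  \<open>norm (x - y)\<close> by at most \<open>2 / n\<close>; dividing, taking logarithms and using
  \<open>ln (1 + t) \<le> t\<close> gives the claim. The last term is unbounded, since
  \<open>x\<close> and \<open>y\<close> may come much closer together than the centres of their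
  bumps; it is only controlled after averaging.\<close>

lemma log_kernel_smear_bound:
  fixes x y u v z :: "'a::euclidean_space"
  assumes \<epsilon>: "0 < \<epsilon>" and n: "0 < (n::nat)" and ne: "x \<noteq> y" "u \<noteq> v"
    and x: "norm (x - (z + \<epsilon> *\<^sub>R u)) < 1 / n" and y: "norm (y - (z + \<epsilon> *\<^sub>R v)) < 1 / n"
  shows "ln (1 / norm (x - y)) + ln (4 * \<epsilon>) \<le> ln 4 + \<bar>ln (1 / norm (v - u))\<bar> + 2 / (n * norm (x - y))"
proof -
  let ?r = "norm (x - y)" and ?s = "norm (v - u)"
  have r: "?r > 0" and s: "?s > 0" using ne by auto
  have "\<epsilon> * ?s = norm ((z + \<epsilon> *\<^sub>R v) - (z + \<epsilon> *\<^sub>R u))" using \<epsilon> by (simp flip: scaleR_diff_right)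
  also have "\<dots> = norm ((x - (z + \<epsilon> *\<^sub>R u)) - (y - (z + \<epsilon> *\<^sub>R v)) - (x - y))" by (simp add: algebra_simps)
  also have "\<dots> \<le> 1 / n + 1 / n + ?r"
    using x y norm_triangle_ineq4[of "(x - (z + \<epsilon> *\<^sub>R u)) - (y - (z + \<epsilon> *\<^sub>R v))" "x - y"]
      norm_triangle_ineq4[of "x - (z + \<epsilon> *\<^sub>R u)" "y - (z + \<epsilon> *\<^sub>R v)"] by linarith
  finally have "\<epsilon> * ?s / ?r \<le> 1 + 2 / (n * ?r)" using r n by (simp add: field_simps)
  then have "ln (\<epsilon> * ?s / ?r) \<le> ln (1 + 2 / (n * ?r))" using r s \<epsilon> by (subst ln_le_cancel_iff) (auto intro: add_pos_nonneg)
  also have "\<dots> \<le> 2 / (n * ?r)" by (rule ln_add_one_self_le_self) auto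
  finally have "ln \<epsilon> + ln ?s - ln ?r \<le> 2 / (n * ?r)" using r s \<epsilon> by (simp add: ln_div ln_mult)
  moreover have "ln (1 / ?r) = - ln ?r" "ln (1 / ?s) = - ln ?s" "ln (4 * \<epsilon>) = ln 4 + ln \<epsilon>"
    using r s \<epsilon> by (simp_all add: ln_div ln_mult)
  ultimately show ?thesis by linarith
qed

section \<open>Energy of rescaled mollifiers\<close>

lemma admissible_mollifier_prob_space:
  assumes "admissible_mollifier \<rho>"
  shows "prob_space \<rho>" "sets \<rho> = sets borel"
  using assms sets_eq_imp_space_eq[of \<rho> borel]
  by (auto simp: admissible_mollifier_def intro!: prob_spaceI)

lemma rescaled_prob_space:
  assumes "admissible_mollifier \<rho>"
  shows "prob_space (rescaled \<rho> z \<epsilon>)" "sets (rescaled \<rho> z \<epsilon>) = sets borel"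
proof -
  note [measurable_cong] = admissible_mollifier_prob_space(2)[OF assms]
  show "prob_space (rescaled \<rho> z \<epsilon>)" unfolding rescaled_def
    by (rule prob_space.prob_space_distr[OF admissible_mollifier_prob_space(1)[OF assms]]) measurable
qed (simp add: rescaled_def)

lemma nn_integral_rescaled:
  assumes "admissible_mollifier \<rho>" and [measurable]: "G \<in> borel_measurable borel"
  shows "(\<integral>\<^sup>+u. G u \<partial>rescaled \<rho> z \<epsilon>) = (\<integral>\<^sup>+u. G (z + \<epsilon> *\<^sub>R u) \<partial>\<rho>)"
proof -
  note [measurable_cong] = admissible_mollifier_prob_space(2)[OF assms(1)]
  show ?thesis unfolding rescaled_def by (subst nn_integral_distr) auto
qed

text \<open>The rescaled mollifier lives within distance \<open>\<epsilon>\<close> of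
  \<open>z\<close>, and smearing adds at most \<open>1 / n\<close>; the hypothesis
  \<open>1 \<le> n * \<epsilon>\<close> makes this at most another
  \<open>\<epsilon>\<close>.\<close>

lemma measure_convolution_rescaled_eq_0:
  assumes \<psi>: "bump_kernel \<psi>" and n: "0 < n" and \<rho>: "admissible_mollifier \<rho>" and \<epsilon>: "0 < \<epsilon>" "1 \<le> n * \<epsilon>"
    and x: "2 * \<epsilon> \<le> norm (x - z)"
  shows "measure_convolution (rescaled \<rho> z \<epsilon>) (bump_scaled \<psi> n) x = 0"
proof -
  note bump_scaled_measurable[OF \<psi>, measurable]
  have "AE u in \<rho>. u \<in> measure_support \<rho>"
    by (rule AE_measure_support) (rule admissible_mollifier_prob_space(2)[OF \<rho>])
  then have "AE u in \<rho>. ennreal (bump_scaled \<psi> n (x - (z + \<epsilon> *\<^sub>R u))) = 0"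
  proof eventually_elim
    case (elim u)
    have "norm u \<le> 1" using elim \<rho> by (auto simp: admissible_mollifier_def)
    then have "norm (\<epsilon> *\<^sub>R u) \<le> \<epsilon>" using \<epsilon> by simp
    then have "\<epsilon> \<le> norm (x - (z + \<epsilon> *\<^sub>R u))"
      using x norm_triangle_ineq2[of "x - z" "\<epsilon> *\<^sub>R u"] by (simp add: diff_diff_eq)
    moreover have "1 / real n \<le> \<epsilon>" using \<epsilon> n by (simp add: field_simps)
    ultimately show ?case using bump_scaled_eq_0[OF \<psi> n, of "x - (z + \<epsilon> *\<^sub>R u)"] by simp
  qed
  then have "(\<integral>\<^sup>+u. ennreal (bump_scaled \<psi> n (x - (z + \<epsilon> *\<^sub>R u))) \<partial>\<rho>) = (\<integral>\<^sup>+u. 0 \<partial>\<rho>)"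
    by (rule nn_integral_cong_AE)
  moreover have "ennreal (measure_convolution (rescaled \<rho> z \<epsilon>) (bump_scaled \<psi> n) x)
      = (\<integral>\<^sup>+u. ennreal (bump_scaled \<psi> n (x - (z + \<epsilon> *\<^sub>R u))) \<partial>\<rho>)"
    unfolding ennreal_measure_convolution[OF \<psi> n rescaled_prob_space[OF \<rho>]]
    by (rule nn_integral_rescaled[OF \<rho>]) measurable
  ultimately have "ennreal (measure_convolution (rescaled \<rho> z \<epsilon>) (bump_scaled \<psi> n) x) = 0" by simp
  then show ?thesis using measure_convolution_nonneg[OF \<psi>, of "rescaled \<rho> z \<epsilon>" n x]
    by (simp add: ennreal_eq_0_iff)
qed

text \<open>Since \<open>ennreal\<close> cuts off negative values, this is the energy of the
  positive part of the shifted kernel. Both convolutions are unfolded into bumps around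
  \<open>z + \<epsilon> *\<^sub>R u\<close> and \<open>z + \<epsilon> *\<^sub>R v\<close>. There the
  kernel is compared with the one at the unscaled points \<open>v\<close> and \<open>u\<close>,
  whose energy does not depend on \<open>z\<close>, \<open>\<epsilon>\<close> or
  \<open>n\<close>.\<close>

lemma mollified_log_energy_bound:
  fixes \<psi> :: "'a::euclidean_space \<Rightarrow> real" and \<rho> :: "'a measure"
  assumes \<psi>: "bump_kernel \<psi>" and d: "DIM('a) \<ge> 2" and \<rho>: "admissible_mollifier \<rho>"
  obtains C where "0 \<le> C" "\<And>n z \<epsilon>. 0 < n \<Longrightarrow> 0 < \<epsilon> \<Longrightarrow> \<epsilon> \<le> 1 \<Longrightarrow>
    (\<integral>\<^sup>+y. (\<integral>\<^sup>+x. ennreal (ln (1 / norm (x - y)) + ln (4 * \<epsilon>))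
       * ennreal (measure_convolution (rescaled \<rho> z \<epsilon>) (bump_scaled \<psi> n) x) \<partial>lborel)
       * ennreal (measure_convolution (rescaled \<rho> z \<epsilon>) (bump_scaled \<psi> n) y) \<partial>lborel) \<le> ennreal C"
proof -
  note bump_scaled_measurable[OF \<psi>, measurable]
  note [measurable_cong] = admissible_mollifier_prob_space(2)[OF \<rho>]
  interpret \<rho>: prob_space \<rho> by (rule admissible_mollifier_prob_space(1)[OF \<rho>])
  obtain C where C: "0 \<le> C" "\<And>n u y. 0 < n \<Longrightarrow>
    (\<integral>\<^sup>+x. ennreal (2 / (real n * norm (x - y))) * ennreal (bump_scaled \<psi> n (x - u)) \<partial>lborel) \<le> ennreal C"
    using nn_integral_inverse_norm_bump[OF \<psi> d] by blast
  define E where "E = (\<integral>\<^sup>+v. (\<integral>\<^sup>+u. abs_log_kernel v u \<partial>\<rho>) \<partial>\<rho>)"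
  have E: "E < \<top>" using \<rho> by (simp add: admissible_mollifier_def E_def)
  \<comment> \<open>The summands are the constant left from the shift, the averaged smearing error,
    and the energy of \<open>\<rho>\<close> itself.\<close>
  show thesis
  proof (rule that[of "ln 4 + C + enn2real E"])
    fix n :: nat and z :: 'a and \<epsilon> :: real
    assume n: "0 < n" and \<epsilon>: "0 < \<epsilon>" "\<epsilon> \<le> 1"
    let ?\<mu> = "rescaled \<rho> z \<epsilon>"
    let ?f = "\<lambda>x. ennreal (measure_convolution ?\<mu> (bump_scaled \<psi> n) x)"
    let ?L = "\<lambda>x y. ennreal (ln (1 / norm (x - y)) + ln (4 * \<epsilon>))"
    let ?T = "\<lambda>u. z + \<epsilon> *\<^sub>R u"
    let ?\<psi> = "\<lambda>x. ennreal (bump_scaled \<psi> n x)"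
    let ?K = "\<lambda>v u. ennreal (ln 4) + abs_log_kernel v u"
    have inner: "(\<integral>\<^sup>+x. G x * ?f x \<partial>lborel) = (\<integral>\<^sup>+u. (\<integral>\<^sup>+x. G x * ?\<psi> (x - ?T u) \<partial>lborel) \<partial>\<rho>)"
      if [measurable]: "G \<in> borel_measurable borel" for G
      unfolding nn_integral_measure_convolution[OF \<psi> n rescaled_prob_space[OF \<rho>] that]
      by (rule nn_integral_rescaled[OF \<rho>]) measurable
    have pw: "?L x y * ?\<psi> (x - ?T u) \<le> (?K v u + ennreal (2 / (real n * norm (x - y)))) * ?\<psi> (x - ?T u)"
      if y: "norm (y - ?T v) < 1 / n" for x y u v
    proof (cases "norm (x - ?T u) < 1 / n")
      case False
      then show ?thesis using bump_scaled_eq_0[OF \<psi> n, of "x - ?T u"] by simp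
    next
      case x: True
      \<comment> \<open>For \<open>u = v\<close> the right-hand side is infinite, by the convention
        for \<open>abs_log_kernel\<close> on the diagonal.\<close>
      have "?L x y \<le> ?K v u + ennreal (2 / (real n * norm (x - y)))"
      proof (cases "u = v")
        case False
        \<comment> \<open>At \<open>x = y\<close> both \<open>ln (1 / 0)\<close> and the error term
          are 0, and \<open>\<epsilon> \<le> 1\<close> settles the claim.\<close>
        have "ln (1 / norm (x - y)) + ln (4 * \<epsilon>) \<le> ln 4 + \<bar>ln (1 / norm (v - u))\<bar> + 2 / (n * norm (x - y))"
        proof (cases "x = y")
          case True
          have "ln (4 * \<epsilon>) \<le> ln 4" using \<epsilon> by (subst ln_le_cancel_iff) auto
          then show ?thesis using True by simp
        qed (rule log_kernel_smear_bound[OF \<epsilon>(1) n _ False x y])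
        then have "?L x y \<le> ennreal (ln 4 + \<bar>ln (1 / norm (v - u))\<bar> + 2 / (n * norm (x - y)))"
          by (intro ennreal_leI) auto
        then show ?thesis using False by (simp add: abs_log_kernel_def ennreal_plus)
      qed (simp add: abs_log_kernel_def)
      then show ?thesis by (intro mult_right_mono) auto
    qed
    have I: "(\<integral>\<^sup>+x. ?L x y * ?f x \<partial>lborel) * ?\<psi> (y - ?T v) \<le> ((\<integral>\<^sup>+u. ?K v u \<partial>\<rho>) + ennreal C) * ?\<psi> (y - ?T v)" for y v
    proof (cases "norm (y - ?T v) < 1 / n")
      case False
      then show ?thesis using bump_scaled_eq_0[OF \<psi> n, of "y - ?T v"] by simp
    next
      case True
      have "(\<integral>\<^sup>+x. ?L x y * ?f x \<partial>lborel) = (\<integral>\<^sup>+u. (\<integral>\<^sup>+x. ?L x y * ?\<psi> (x - ?T u) \<partial>lborel) \<partial>\<rho>)"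
        by (rule inner) measurable
      also have "\<dots> \<le> (\<integral>\<^sup>+u. (\<integral>\<^sup>+x. (?K v u + ennreal (2 / (real n * norm (x - y)))) * ?\<psi> (x - ?T u) \<partial>lborel) \<partial>\<rho>)"
        by (intro nn_integral_mono pw[OF True])
      also have "\<dots> \<le> (\<integral>\<^sup>+u. ?K v u + ennreal C \<partial>\<rho>)"
      proof (intro nn_integral_mono)
        fix u
        have "(\<integral>\<^sup>+x. (?K v u + ennreal (2 / (real n * norm (x - y)))) * ?\<psi> (x - ?T u) \<partial>lborel)
          = ?K v u * (\<integral>\<^sup>+x. ?\<psi> (x - ?T u) \<partial>lborel)
            + (\<integral>\<^sup>+x. ennreal (2 / (real n * norm (x - y))) * ?\<psi> (x - ?T u) \<partial>lborel)"
          unfolding distrib_right[of "?K v u"] by (subst nn_integral_add; (subst nn_integral_cmult)?; simp)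
        also have "\<dots> \<le> ?K v u * 1 + ennreal C"
          using C(2)[OF n] nn_integral_bump_scaled[OF \<psi> n] by (intro add_mono) auto
        finally show "(\<integral>\<^sup>+x. (?K v u + ennreal (2 / (real n * norm (x - y)))) * ?\<psi> (x - ?T u) \<partial>lborel) \<le> ?K v u + ennreal C"
          by simp
      qed
      also have "\<dots> = (\<integral>\<^sup>+u. ?K v u \<partial>\<rho>) + ennreal C"
        by (subst nn_integral_add) (auto simp: \<rho>.emeasure_space_1)
      finally show ?thesis by (intro mult_right_mono) auto
    qed
    \<comment> \<open>The second convolution is unfolded with the whole inner integral as
      weight.\<close>
    have "(\<integral>\<^sup>+y. (\<integral>\<^sup>+x. ?L x y * ?f x \<partial>lborel) * ?f y \<partial>lborel)
      = (\<integral>\<^sup>+v. (\<integral>\<^sup>+y. (\<integral>\<^sup>+x. ?L x y * ?f x \<partial>lborel) * ?\<psi> (y - ?T v) \<partial>lborel) \<partial>\<rho>)"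
    proof (rule inner)
      note smooth_borel_measurable[OF measure_convolution_bump(1)[OF \<psi> n rescaled_prob_space[OF \<rho>]], measurable]
      show "(\<lambda>y. \<integral>\<^sup>+x. ?L x y * ?f x \<partial>lborel) \<in> borel_measurable borel" by measurable
    qed
    also have "\<dots> \<le> (\<integral>\<^sup>+v. (\<integral>\<^sup>+y. ((\<integral>\<^sup>+u. ?K v u \<partial>\<rho>) + ennreal C) * ?\<psi> (y - ?T v) \<partial>lborel) \<partial>\<rho>)"
      by (intro nn_integral_mono I)
    also have "\<dots> = (\<integral>\<^sup>+v. (\<integral>\<^sup>+u. ?K v u \<partial>\<rho>) + ennreal C \<partial>\<rho>)"
      by (intro nn_integral_cong) (simp add: nn_integral_cmult nn_integral_bump_scaled[OF \<psi> n])
    also have "\<dots> = (\<integral>\<^sup>+v. ennreal (ln 4 + C) + (\<integral>\<^sup>+u. abs_log_kernel v u \<partial>\<rho>) \<partial>\<rho>)"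
      using C(1) by (intro nn_integral_cong, subst nn_integral_add)
        (auto simp: \<rho>.emeasure_space_1 ennreal_plus ac_simps)
    also have "\<dots> = ennreal (ln 4 + C) + E"
      unfolding E_def by (subst nn_integral_add) (auto simp: \<rho>.emeasure_space_1)
    also have "\<dots> = ennreal (ln 4 + C + enn2real E)"
      using E C(1) by (simp add: ennreal_plus ennreal_enn2real)
    finally show "(\<integral>\<^sup>+y. (\<integral>\<^sup>+x. ?L x y * ?f x \<partial>lborel) * ?f y \<partial>lborel) \<le> ennreal (ln 4 + C + enn2real E)" .
  qed (use C in auto)
qed

text \<open>As only an upper bound is claimed, it suffices to treat the positive part of the
  integrand. The mixed energy of \<open>\<rho>\<close> and \<open>\<sigma>\<close> never has to be
  estimated, because it enters with a minus sign in front of a nonnegative kernel.\<close>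

lemma mollifier_difference_log_energy_bound:
  fixes \<psi> :: "'a::euclidean_space \<Rightarrow> real" and \<rho> \<sigma> :: "'a measure"
  assumes \<psi>: "bump_kernel \<psi>" and d: "DIM('a) \<ge> 2" and \<rho>: "admissible_mollifier \<rho>" and \<sigma>: "admissible_mollifier \<sigma>"
  obtains C where "0 \<le> C" "\<And>n z \<epsilon> f. 0 < n \<Longrightarrow> 0 < \<epsilon> \<Longrightarrow> \<epsilon> \<le> 1 \<Longrightarrow> 1 \<le> real n * \<epsilon> \<Longrightarrow>
    f = (\<lambda>x. measure_convolution (rescaled \<rho> z \<epsilon>) (bump_scaled \<psi> n) x
           - measure_convolution (rescaled \<sigma> z \<epsilon>) (bump_scaled \<psi> n) x) \<Longrightarrow>
    (LINT (x, y)|(lborel \<Otimes>\<^sub>M lborel). ln (1 / norm (x - y)) * f x * f y) \<le> C"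
proof -
  obtain C1 where C1: "0 \<le> C1" "\<And>n z \<epsilon>. 0 < n \<Longrightarrow> 0 < \<epsilon> \<Longrightarrow> \<epsilon> \<le> 1 \<Longrightarrow>
    (\<integral>\<^sup>+y. (\<integral>\<^sup>+x. ennreal (ln (1 / norm (x - y)) + ln (4 * \<epsilon>))
       * ennreal (measure_convolution (rescaled \<rho> z \<epsilon>) (bump_scaled \<psi> n) x) \<partial>lborel)
       * ennreal (measure_convolution (rescaled \<rho> z \<epsilon>) (bump_scaled \<psi> n) y) \<partial>lborel) \<le> ennreal C1"
    by (rule mollified_log_energy_bound[OF \<psi> d \<rho>]; blast)
  obtain C2 where C2: "0 \<le> C2" "\<And>n z \<epsilon>. 0 < n \<Longrightarrow> 0 < \<epsilon> \<Longrightarrow> \<epsilon> \<le> 1 \<Longrightarrow>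
    (\<integral>\<^sup>+y. (\<integral>\<^sup>+x. ennreal (ln (1 / norm (x - y)) + ln (4 * \<epsilon>))
       * ennreal (measure_convolution (rescaled \<sigma> z \<epsilon>) (bump_scaled \<psi> n) x) \<partial>lborel)
       * ennreal (measure_convolution (rescaled \<sigma> z \<epsilon>) (bump_scaled \<psi> n) y) \<partial>lborel) \<le> ennreal C2"
    by (rule mollified_log_energy_bound[OF \<psi> d \<sigma>]; blast)
  show thesis
  proof (rule that[of "C1 + C2"])
    fix n :: nat and z :: 'a and \<epsilon> :: real and f :: "'a \<Rightarrow> real"
    assume n: "0 < n" and \<epsilon>: "0 < \<epsilon>" "\<epsilon> \<le> 1" and n\<epsilon>: "1 \<le> real n * \<epsilon>"
    define a where "a = measure_convolution (rescaled \<rho> z \<epsilon>) (bump_scaled \<psi> n)"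
    define b where "b = measure_convolution (rescaled \<sigma> z \<epsilon>) (bump_scaled \<psi> n)"
    assume "f = (\<lambda>x. measure_convolution (rescaled \<rho> z \<epsilon>) (bump_scaled \<psi> n) x
           - measure_convolution (rescaled \<sigma> z \<epsilon>) (bump_scaled \<psi> n) x)"
    then have f: "f = (\<lambda>x. a x - b x)" by (simp add: a_def b_def)
    note a = measure_convolution_bump[OF \<psi> n rescaled_prob_space[OF \<rho>], of z \<epsilon>, folded a_def]
    note b = measure_convolution_bump[OF \<psi> n rescaled_prob_space[OF \<sigma>], of z \<epsilon>, folded b_def]
    note [measurable] = smooth_borel_measurable[OF a(1)] smooth_borel_measurable[OF b(1)]
    have f_meas [measurable]: "f \<in> borel_measurable borel" unfolding f by measurable
    have a0: "0 \<le> a x" and b0: "0 \<le> b x" for x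
      unfolding a_def b_def by (auto intro: measure_convolution_nonneg[OF \<psi>])
    have supp: "norm (x - z) < 2 * \<epsilon>" if "f x \<noteq> 0" for x
      using that measure_convolution_rescaled_eq_0[OF \<psi> n \<rho> \<epsilon>(1) n\<epsilon>, of x z]
        measure_convolution_rescaled_eq_0[OF \<psi> n \<sigma> \<epsilon>(1) n\<epsilon>, of x z]
      by (force simp: f a_def b_def not_le[symmetric])
    have f_int: "integrable lborel f" "(LINT x|lborel. f x) = 0"
      unfolding f using a(2,3) b(2,3) by auto
    let ?N = "lborel \<Otimes>\<^sub>M lborel :: ('a \<times> 'a) measure"
    \<comment> \<open>Both mollifiers live in a set of diameter \<open>4 * \<epsilon>\<close>, so adding this constant to the kernel makes it
      nonnegative there; it does not change the energy, because \<open>f\<close> has integral zero.\<close>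
    let ?c = "ln (4 * \<epsilon>)"
    let ?l = "\<lambda>x y. ln (1 / norm (x - y :: 'a))"
    have P: "integrable ?N (\<lambda>(x, y). f x * f y)"
    proof (rule lborel_pair.Fubini_integrable)
      show "integrable lborel (\<lambda>x. \<integral>y. norm (case (x, y) of (x, y) \<Rightarrow> f x * f y) \<partial>lborel)"
        using f_int(1) by (simp add: abs_mult)
      show "AE x in lborel. integrable lborel (\<lambda>y. case (x, y) of (x, y) \<Rightarrow> f x * f y)"
        using f_int(1) by simp
    qed measurable
    have P0: "(LINT (x, y)|?N. f x * f y) = 0"
      using lborel_pair.integral_fst'[OF P] f_int(2) by simp
    show "(LINT (x, y)|?N. ?l x y * f x * f y) \<le> C1 + C2"
    proof (cases "integrable ?N (\<lambda>(x, y). ?l x y * f x * f y)")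
      case False
      \<comment> \<open>The Bochner integral then has the junk value 0.\<close>
      then show ?thesis using C1(1) C2(1) by (simp add: not_integrable_integral_eq)
    next
      case True
      let ?F = "\<lambda>(x, y). (?l x y + ?c) * (f x * f y)"
      have "?F = (\<lambda>w. (case w of (x, y) \<Rightarrow> ?l x y * f x * f y) + ?c * (case w of (x, y) \<Rightarrow> f x * f y))"
        by (auto simp: fun_eq_iff algebra_simps)
      then have F: "integrable ?N ?F" "(LINT w|?N. ?F w) = (LINT (x, y)|?N. ?l x y * f x * f y)"
        using True P P0 by simp_all
      let ?L = "\<lambda>x y. ennreal (?l x y + ?c)"
      have pw: "ennreal ((?l x y + ?c) * (f x * f y))
         \<le> ?L x y * ennreal (a x) * ennreal (a y) + ?L x y * ennreal (b x) * ennreal (b y)" for x y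
      proof (cases "f x * f y = 0")
        case False
        have dist: "norm (x - y) < 4 * \<epsilon>"
          using supp[of x] supp[of y] False norm_triangle_ineq4[of "x - z" "y - z"] by simp
        \<comment> \<open>Off the diagonal the shifted kernel is nonnegative, and dropping the cross
          terms increases \<open>f x * f y\<close>. On the diagonal the kernel has the value
          \<open>ln (1 / 0) = 0\<close> and \<open>?c\<close> may be negative, but
          \<open>f x * f y\<close> is then a square.\<close>
        have "(?l x y + ?c) * (f x * f y) \<le> max 0 (?l x y + ?c) * (a x * a y + b x * b y)"
        proof (cases "x = y")
          case True
          have "0 \<le> f x * f y" using True by simp
          moreover have "f x * f y \<le> a x * a y + b x * b y"
            using True a0[of x] b0[of x] by (simp add: f algebra_simps)
          ultimately show ?thesis
            by (intro order_trans[OF mult_right_mono mult_left_mono]) auto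
        next
          case ne: False
          have "?l x y + ?c = ln (4 * \<epsilon> / norm (x - y))" using ne \<epsilon> by (simp add: ln_div)
          also have "\<dots> \<ge> 0" using ne dist by (intro ln_ge_zero) (simp add: field_simps)
          finally have "0 \<le> ?l x y + ?c" .
          moreover have "f x * f y \<le> a x * a y + b x * b y"
            using a0[of x] b0[of x] a0[of y] b0[of y] by (simp add: f algebra_simps)
          ultimately show ?thesis by (simp add: max_def mult_left_mono)
        qed
        then have "ennreal ((?l x y + ?c) * (f x * f y)) \<le> ennreal (max 0 (?l x y + ?c) * (a x * a y + b x * b y))"
          by (rule ennreal_leI)
        also have "\<dots> = ?L x y * ennreal (a x) * ennreal (a y) + ?L x y * ennreal (b x) * ennreal (b y)"
          using a0 b0 by (simp add: ennreal_mult' ennreal_plus distrib_left mult.assoc)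
        finally show ?thesis .
      qed (simp only: mult_zero_right ennreal_0 zero_le)
      have fin: "(\<integral>\<^sup>+w. ennreal (?F w) \<partial>?N) \<le> ennreal (C1 + C2)"
      proof -
        have "(\<integral>\<^sup>+w. ennreal (?F w) \<partial>?N) \<le>
          (\<integral>\<^sup>+(x, y). ?L x y * ennreal (a x) * ennreal (a y) + ?L x y * ennreal (b x) * ennreal (b y) \<partial>?N)"
          by (intro nn_integral_mono) (auto intro: pw)
        also have "\<dots> = (\<integral>\<^sup>+y. \<integral>\<^sup>+x. ?L x y * ennreal (a x) * ennreal (a y) + ?L x y * ennreal (b x) * ennreal (b y) \<partial>lborel \<partial>lborel)"
          by (subst lborel_pair.nn_integral_snd[symmetric]) auto
        also have "\<dots> = (\<integral>\<^sup>+y. (\<integral>\<^sup>+x. ?L x y * ennreal (a x) \<partial>lborel) * ennreal (a y)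
            + (\<integral>\<^sup>+x. ?L x y * ennreal (b x) \<partial>lborel) * ennreal (b y) \<partial>lborel)"
          by (intro nn_integral_cong, subst nn_integral_add) (auto simp: nn_integral_multc)
        also have "\<dots> = (\<integral>\<^sup>+y. (\<integral>\<^sup>+x. ?L x y * ennreal (a x) \<partial>lborel) * ennreal (a y) \<partial>lborel)
            + (\<integral>\<^sup>+y. (\<integral>\<^sup>+x. ?L x y * ennreal (b x) \<partial>lborel) * ennreal (b y) \<partial>lborel)"
          by (rule nn_integral_add) measurable
        also have "\<dots> \<le> ennreal C1 + ennreal C2"
          unfolding a_def b_def by (intro add_mono C1(2) C2(2) n \<epsilon>)
        finally show ?thesis using C1(1) C2(1) by (simp add: ennreal_plus)
      qed
      \<comment> \<open>The integral is that of the positive part minus that of the negative part;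
        the latter is discarded.\<close>
      have "(LINT w|?N. ?F w) \<le> enn2real (\<integral>\<^sup>+w. ennreal (?F w) \<partial>?N)"
        unfolding real_lebesgue_integral_def[OF F(1)] by simp
      also have "\<dots> \<le> enn2real (ennreal (C1 + C2))" by (rule enn2real_mono[OF fin]) simp
      also have "\<dots> = C1 + C2" using C1(1) C2(1) by (intro enn2real_ennreal) auto
      finally show ?thesis using F(2) by simp
    qed
  qed (use C1 C2 in auto)
qed

section \<open>Gaussian tails\<close>

context prob_space
begin

text \<open>Markov's inequality for \<open>exp (X^2 / (4 s^2))\<close>. Half of the Gaussian
  exponent is spent on this weight: the product of weight and density is \<open>sqrt 2\<close> times
  a normal density of twice the variance, so the expectation is \<open>sqrt 2\<close>, which is
  rounded up to 2.\<close>

lemma normal_density_tail: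
  assumes X: "distributed M lborel X (normal_density 0 s)" and s: "0 < s" "s\<^sup>2 \<le> v" and a: "a \<ge> 0"
  shows "prob {\<omega> \<in> space M. a \<le> \<bar>X \<omega>\<bar>} \<le> 2 * exp (- a\<^sup>2 / (4 * v))"
proof -
  have [measurable]: "X \<in> borel_measurable M" using distributed_measurable[OF X] by simp
  have dens: "normal_density 0 s x * exp (x\<^sup>2 / (4 * s\<^sup>2)) = sqrt 2 * normal_density 0 (sqrt 2 * s) x" for x
  proof -
    have "- x\<^sup>2 / (2 * s\<^sup>2) + x\<^sup>2 / (4 * s\<^sup>2) = - x\<^sup>2 / (2 * (sqrt 2 * s)\<^sup>2)"
      using s by (simp add: field_simps power_mult_distrib)
    moreover have "sqrt (2 * pi * (sqrt 2 * s)\<^sup>2) = sqrt 2 * sqrt (2 * pi * s\<^sup>2)"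
      by (simp add: real_sqrt_mult power_mult_distrib)
    ultimately show ?thesis
      using s unfolding normal_density_def by (simp add: exp_add[symmetric] field_simps)
  qed
  have "(\<integral>\<^sup>+\<omega>. ennreal (exp ((X \<omega>)\<^sup>2 / (4 * s\<^sup>2))) \<partial>M)
      = (\<integral>\<^sup>+x. ennreal (normal_density 0 s x) * ennreal (exp (x\<^sup>2 / (4 * s\<^sup>2))) \<partial>lborel)"
    by (subst distributed_nn_integral[OF X]) auto
  also have "\<dots> = (\<integral>\<^sup>+x. ennreal (sqrt 2) * ennreal (normal_density 0 (sqrt 2 * s) x) \<partial>lborel)"
    by (simp add: ennreal_mult'[symmetric] dens)
  also have "\<dots> = ennreal (sqrt 2)"
    using s by (subst nn_integral_cmult) (auto simp: nn_integral_eq_integral)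
  finally have E: "(\<integral>\<^sup>+\<omega>. ennreal (exp ((X \<omega>)\<^sup>2 / (4 * s\<^sup>2))) \<partial>M) = ennreal (sqrt 2)" .
  let ?A = "{\<omega> \<in> space M. a \<le> \<bar>X \<omega>\<bar>}"
  have "emeasure M ?A = (\<integral>\<^sup>+\<omega>. indicator ?A \<omega> \<partial>M)" by simp
  also have "\<dots> \<le> (\<integral>\<^sup>+\<omega>. ennreal (exp (- a\<^sup>2 / (4 * s\<^sup>2))) * ennreal (exp ((X \<omega>)\<^sup>2 / (4 * s\<^sup>2))) \<partial>M)"
  proof (rule nn_integral_mono)
    fix \<omega>
    have "1 \<le> exp (- a\<^sup>2 / (4 * s\<^sup>2)) * exp ((X \<omega>)\<^sup>2 / (4 * s\<^sup>2))" if "a \<le> \<bar>X \<omega>\<bar>"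
    proof -
      have "a\<^sup>2 \<le> (X \<omega>)\<^sup>2" using power_mono[OF that a, of 2] by simp
      then show ?thesis using s by (simp add: exp_add[symmetric] divide_right_mono)
    qed
    then show "indicator ?A \<omega> \<le> ennreal (exp (- a\<^sup>2 / (4 * s\<^sup>2))) * ennreal (exp ((X \<omega>)\<^sup>2 / (4 * s\<^sup>2)))"
      by (auto simp: indicator_def ennreal_mult'[symmetric] ennreal_1[symmetric] simp del: ennreal_1 intro: ennreal_leI)
  qed
  also have "\<dots> = ennreal (exp (- a\<^sup>2 / (4 * s\<^sup>2)) * sqrt 2)"
    by (subst nn_integral_cmult) (auto simp: E ennreal_mult')
  finally have "prob ?A \<le> exp (- a\<^sup>2 / (4 * s\<^sup>2)) * sqrt 2"
    by (simp add: emeasure_eq_measure)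
  also have "\<dots> \<le> exp (- a\<^sup>2 / (4 * v)) * 2"
  proof (intro mult_mono)
    have "0 < v" using s by (meson less_le_trans zero_less_power)
    then have "a\<^sup>2 / (4 * v) \<le> a\<^sup>2 / (4 * s\<^sup>2)" using s by (intro divide_left_mono) auto
    then show "exp (- a\<^sup>2 / (4 * s\<^sup>2)) \<le> exp (- a\<^sup>2 / (4 * v))" by simp
    show "sqrt 2 \<le> 2" by (rule real_le_lsqrt) auto
  qed auto
  finally show ?thesis by (simp add: mult.commute)
qed

text \<open>The means subtracted in \<open>covariance\<close> vanish, so the energy formula becomes
  a formula for second moments. The point mass at 0 is treated separately, as it has no
  density.\<close>

lemma centered_gaussian_second_moment:
  assumes "centered_gaussian M X"
  shows "integrable M (\<lambda>\<omega>. (X \<omega>)\<^sup>2)" "expectation X = 0" "covariance M X X = (\<integral>\<omega>. (X \<omega>)\<^sup>2 \<partial>M)"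
proof -
  have [measurable]: "X \<in> borel_measurable M" using assms by (simp add: centered_gaussian_def)
  have *: "integrable M (\<lambda>\<omega>. (X \<omega>)\<^sup>2) \<and> expectation X = 0"
  proof (cases "distr M borel X = return borel 0")
    case True
    have "AE x in distr M borel X. x = 0" unfolding True by (subst AE_return) auto
    then have "AE \<omega> in M. X \<omega> = 0" by (subst (asm) AE_distr_iff) auto
    then have "AE \<omega> in M. (X \<omega>)\<^sup>2 = 0" by auto
    then have "integrable M (\<lambda>\<omega>. (X \<omega>)\<^sup>2) = integrable M (\<lambda>\<omega>. 0::real)"
      by (intro integrable_cong_AE) auto
    moreover have "expectation X = (\<integral>\<omega>. 0 \<partial>M)"
      by (intro integral_cong_AE) (use \<open>AE \<omega> in M. X \<omega> = 0\<close> in auto)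
    ultimately show ?thesis by simp
  next
    case False
    then obtain s where s: "s > 0" and D: "distributed M lborel X (normal_density 0 s)"
      using assms by (auto simp: centered_gaussian_def)
    have "integrable lborel (\<lambda>x. normal_density 0 s x * x\<^sup>2)"
      using integrable_normal_moment[OF s, of 0 2] by simp
    then have "integrable M (\<lambda>\<omega>. (X \<omega>)\<^sup>2)"
      by (subst distributed_integrable[OF D, symmetric]) auto
    then show ?thesis using normal_distributed_expectation[OF s D] by simp
  qed
  then show "integrable M (\<lambda>\<omega>. (X \<omega>)\<^sup>2)" "expectation X = 0" by auto
  then show "covariance M X X = (\<integral>\<omega>. (X \<omega>)\<^sup>2 \<partial>M)"
    by (simp add: covariance_def power2_eq_square)
qed

lemma centered_gaussian_tail:
  assumes "centered_gaussian M X" "(\<integral>\<omega>. (X \<omega>)\<^sup>2 \<partial>M) \<le> v" "0 \<le> a"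
  shows "prob {\<omega> \<in> space M. a \<le> \<bar>X \<omega>\<bar>} \<le> 2 * exp (- a\<^sup>2 / (4 * v))"
proof (cases "distr M borel X = return borel 0")
  case True
  have [measurable]: "X \<in> borel_measurable M" using assms by (simp add: centered_gaussian_def)
  have "AE x in distr M borel X. x = 0" unfolding True by (subst AE_return) auto
  then have AE: "AE \<omega> in M. X \<omega> = 0" by (subst (asm) AE_distr_iff) auto
  \<comment> \<open>At \<open>a = 0\<close> the right-hand side equals 2 and the bound is
    trivial.\<close>
  show ?thesis
  proof (cases "a = 0")
    case True
    then show ?thesis using prob_le_1 by (simp add: order_trans[OF prob_le_1])
  next
    case False
    then have "AE \<omega> in M. \<not> a \<le> \<bar>X \<omega>\<bar>" using AE assms(3) by auto
    then have "prob {\<omega> \<in> space M. a \<le> \<bar>X \<omega>\<bar>} = 0"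
      by (subst prob_eq_0) auto
    then show ?thesis by simp
  qed
next
  case False
  then obtain s where s: "s > 0" and D: "distributed M lborel X (normal_density 0 s)"
    using assms by (auto simp: centered_gaussian_def)
  have "s\<^sup>2 \<le> v"
    using normal_distributed_variance[OF s D] normal_distributed_expectation[OF s D] assms(2) by simp
  then show ?thesis by (rule normal_density_tail[OF D s _ assms(3)])
qed

text \<open>Chebyshev's inequality passes the Gaussian tail to the limit at the price of a factor.\<close>

lemma gaussian_tail_of_L2_limit:
  assumes G: "\<And>n. centered_gaussian M (Y n)" and [measurable]: "Z \<in> borel_measurable M"
    and v: "\<forall>\<^sub>F n in sequentially. (\<integral>\<omega>. (Y n \<omega>)\<^sup>2 \<partial>M) \<le> v"
    and lim: "(\<lambda>n. \<integral>\<^sup>+ \<omega>. ennreal ((Y n \<omega> - Z \<omega>)\<^sup>2) \<partial>M) \<longlonglongrightarrow> 0"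
    and a: "0 < a"
  shows "prob {\<omega> \<in> space M. a \<le> \<bar>Z \<omega>\<bar>} \<le> 2 * exp (- a\<^sup>2 / (16 * v))"
proof -
  have [measurable]: "Y n \<in> borel_measurable M" for n using G by (simp add: centered_gaussian_def)
  define I where "I n = (\<integral>\<^sup>+ \<omega>. ennreal ((Y n \<omega> - Z \<omega>)\<^sup>2) \<partial>M)" for n
  have "emeasure M {\<omega> \<in> space M. a \<le> \<bar>Z \<omega>\<bar>}
      \<le> ennreal (2 * exp (- a\<^sup>2 / (16 * v))) + ennreal (4 / a\<^sup>2) * I n"
    if n: "(\<integral>\<omega>. (Y n \<omega>)\<^sup>2 \<partial>M) \<le> v" for n
  proof -
    let ?A = "{\<omega> \<in> space M. a / 2 \<le> \<bar>Y n \<omega>\<bar>}"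
    \<comment> \<open>The event that \<open>Y n\<close> and \<open>Z\<close> differ by at least
      \<open>a / 2\<close>, in the shape of Markov's inequality. The other half of \<open>a\<close>
      is left for \<open>Y n\<close>, which turns \<open>4 * v\<close> into
      \<open>16 * v\<close>.\<close>
    let ?B = "{\<omega> \<in> space M. 1 \<le> ennreal (4 / a\<^sup>2) * ennreal ((Y n \<omega> - Z \<omega>)\<^sup>2)}"
    have "{\<omega> \<in> space M. a \<le> \<bar>Z \<omega>\<bar>} \<subseteq> ?A \<union> ?B"
    proof safe
      fix \<omega> assume \<omega>: "\<omega> \<in> space M" "a \<le> \<bar>Z \<omega>\<bar>" and "\<not> 1 \<le> ennreal (4 / a\<^sup>2) * ennreal ((Y n \<omega> - Z \<omega>)\<^sup>2)"
      then have "4 / a\<^sup>2 * (Y n \<omega> - Z \<omega>)\<^sup>2 < 1"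
        by (simp add: ennreal_mult'[symmetric] not_le flip: ennreal_1)
      then have "(Y n \<omega> - Z \<omega>)\<^sup>2 < (a / 2)\<^sup>2" using a by (simp add: field_simps power2_eq_square)
      then have "\<bar>Y n \<omega> - Z \<omega>\<bar> < a / 2"
        using a abs_le_square_iff[of "a/2" "Y n \<omega> - Z \<omega>"] by (simp add: not_le[symmetric])
      then show "a / 2 \<le> \<bar>Y n \<omega>\<bar>" using \<omega>(2) by linarith
    qed
    then have "emeasure M {\<omega> \<in> space M. a \<le> \<bar>Z \<omega>\<bar>} \<le> emeasure M (?A \<union> ?B)" by (intro emeasure_mono) auto
    also have "\<dots> \<le> emeasure M ?A + emeasure M ?B" by (intro emeasure_subadditive) auto
    also have "emeasure M ?B \<le> ennreal (4 / a\<^sup>2) * I n"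
      using nn_integral_Markov_inequality[where A="space M" and M=M and u="\<lambda>\<omega>. ennreal ((Y n \<omega> - Z \<omega>)\<^sup>2)" and c="ennreal (4 / a\<^sup>2)"]
      by (simp add: I_def Collect_conj_eq cong: nn_integral_cong)
    also have "emeasure M ?A \<le> ennreal (2 * exp (- a\<^sup>2 / (16 * v)))"
      using centered_gaussian_tail[OF G n, of "a/2"] a by (simp add: emeasure_eq_measure power_divide)
    finally show ?thesis by (auto intro: add_mono)
  qed
  with v have ev: "\<forall>\<^sub>F n in sequentially. emeasure M {\<omega> \<in> space M. a \<le> \<bar>Z \<omega>\<bar>}
      \<le> ennreal (2 * exp (- a\<^sup>2 / (16 * v))) + ennreal (4 / a\<^sup>2) * I n"
    by (auto elim: eventually_mono)
  \<comment> \<open>The level \<open>a\<close> stays fixed while \<open>n\<close> grows, so the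
    Chebyshev term vanishes in the limit.\<close>
  have "(\<lambda>n. ennreal (2 * exp (- a\<^sup>2 / (16 * v))) + ennreal (4 / a\<^sup>2) * I n)
      \<longlonglongrightarrow> ennreal (2 * exp (- a\<^sup>2 / (16 * v))) + ennreal (4 / a\<^sup>2) * 0"
    using lim unfolding I_def[symmetric]
    by (intro tendsto_add ennreal_tendsto_cmult tendsto_const) auto
  then have "emeasure M {\<omega> \<in> space M. a \<le> \<bar>Z \<omega>\<bar>} \<le> ennreal (2 * exp (- a\<^sup>2 / (16 * v))) + ennreal (4 / a\<^sup>2) * 0"
    using ev by (intro tendsto_lowerbound[where F=sequentially]) auto
  then show ?thesis by (simp add: emeasure_eq_measure)
qed

text \<open>The variant for increments, where Condition $(A_p)$ bounds the second moment of the
  limit. Once the $L^2$ error is below \<open>v / 2\<close>, the approximants have second moment at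
  most \<open>2 * (v / 2) + 2 * v = 3 * v\<close>, and \<open>16 * 3 = 48\<close>.\<close>

lemma gaussian_tail_of_L2_limit_norm:
  assumes G: "\<And>n. centered_gaussian M (Y n)" and [measurable]: "Z \<in> borel_measurable M"
    and lim: "(\<lambda>n. \<integral>\<^sup>+ \<omega>. ennreal ((Y n \<omega> - Z \<omega>)\<^sup>2) \<partial>M) \<longlonglongrightarrow> 0"
    and v: "(\<integral>\<^sup>+ \<omega>. ennreal ((Z \<omega>)\<^sup>2) \<partial>M) \<le> ennreal v" "0 < v"
    and a: "0 < a"
  shows "prob {\<omega> \<in> space M. a \<le> \<bar>Z \<omega>\<bar>} \<le> 2 * exp (- a\<^sup>2 / (48 * v))"
proof -
  have [measurable]: "Y n \<in> borel_measurable M" for n using G by (simp add: centered_gaussian_def)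
  have "\<forall>\<^sub>F n in sequentially. (\<integral>\<^sup>+ \<omega>. ennreal ((Y n \<omega> - Z \<omega>)\<^sup>2) \<partial>M) < ennreal (v / 2)"
    by (rule order_tendstoD(2)[OF lim]) (use v in auto)
  then have "\<forall>\<^sub>F n in sequentially. (\<integral>\<omega>. (Y n \<omega>)\<^sup>2 \<partial>M) \<le> 3 * v"
  proof eventually_elim
    case (elim n)
    have "ennreal (\<integral>\<omega>. (Y n \<omega>)\<^sup>2 \<partial>M) = (\<integral>\<^sup>+ \<omega>. ennreal ((Y n \<omega>)\<^sup>2) \<partial>M)"
      using centered_gaussian_second_moment(1)[OF G] by (simp add: nn_integral_eq_integral)
    also have "\<dots> \<le> (\<integral>\<^sup>+ \<omega>. 2 * ennreal ((Y n \<omega> - Z \<omega>)\<^sup>2) + 2 * ennreal ((Z \<omega>)\<^sup>2) \<partial>M)"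
    proof (rule nn_integral_mono)
      fix \<omega>
      have "0 \<le> (Y n \<omega> - 2 * Z \<omega>)\<^sup>2" by simp
      then have "(Y n \<omega>)\<^sup>2 \<le> 2 * (Y n \<omega> - Z \<omega>)\<^sup>2 + 2 * (Z \<omega>)\<^sup>2"
        by (simp add: power2_eq_square algebra_simps)
      then have "ennreal ((Y n \<omega>)\<^sup>2) \<le> ennreal (2 * (Y n \<omega> - Z \<omega>)\<^sup>2 + 2 * (Z \<omega>)\<^sup>2)" by (rule ennreal_leI)
      then show "ennreal ((Y n \<omega>)\<^sup>2) \<le> 2 * ennreal ((Y n \<omega> - Z \<omega>)\<^sup>2) + 2 * ennreal ((Z \<omega>)\<^sup>2)"
        by (simp add: ennreal_plus ennreal_mult')
    qed
    also have "\<dots> = 2 * (\<integral>\<^sup>+ \<omega>. ennreal ((Y n \<omega> - Z \<omega>)\<^sup>2) \<partial>M) + 2 * (\<integral>\<^sup>+ \<omega>. ennreal ((Z \<omega>)\<^sup>2) \<partial>M)"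
      by (subst nn_integral_add) (auto simp: nn_integral_cmult)
    also have "\<dots> \<le> 2 * ennreal (v / 2) + 2 * ennreal v"
      using elim v by (intro add_mono mult_left_mono) auto
    also have "\<dots> = ennreal (3 * v)"
      using v by (simp add: ennreal_plus[symmetric] ennreal_mult'[symmetric] flip: ennreal_numeral)
    finally show ?case using v by (simp add: ennreal_le_iff)
  qed
  from gaussian_tail_of_L2_limit[OF G _ this lim a] show ?thesis by simp
qed

end

section \<open>Chaining\<close>

definition dyadic_floor :: "nat \<Rightarrow> 'a::euclidean_space \<Rightarrow> 'a" where
  "dyadic_floor k q = (\<Sum>b\<in>Basis. (of_int \<lfloor>2 ^ k * (q \<bullet> b)\<rfloor> / 2 ^ k) *\<^sub>R b)"

lemma dyadic_floor_inner_Basis: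
  "b \<in> Basis \<Longrightarrow> dyadic_floor k q \<bullet> b = of_int \<lfloor>2 ^ k * (q \<bullet> b)\<rfloor> / 2 ^ k"
  by (simp add: dyadic_floor_def)

lemma norm_diff_dyadic_floor:
  fixes q :: "'a::euclidean_space"
  shows "norm (q - dyadic_floor k q) \<le> DIM('a) / 2 ^ k"
proof -
  have "norm (q - dyadic_floor k q) \<le> (\<Sum>b\<in>Basis. \<bar>(q - dyadic_floor k q) \<bullet> b\<bar>)" by (rule norm_le_l1)
  also have "\<dots> \<le> (\<Sum>b\<in>(Basis::'a set). 1 / 2 ^ k)"
  proof (rule sum_mono)
    fix b :: 'a assume b: "b \<in> Basis"
    let ?x = "q \<bullet> b"
    have "q \<bullet> b - of_int \<lfloor>2 ^ k * ?x\<rfloor> / 2 ^ k = (2 ^ k * ?x - of_int \<lfloor>2 ^ k * ?x\<rfloor>) / 2 ^ k"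
      by (simp add: field_simps)
    moreover have "\<bar>2 ^ k * ?x - of_int \<lfloor>2 ^ k * ?x\<rfloor>\<bar> \<le> 1" by linarith
    ultimately show "\<bar>(q - dyadic_floor k q) \<bullet> b\<bar> \<le> 1 / 2 ^ k"
      using b by (simp add: dyadic_floor_inner_Basis inner_diff_left divide_right_mono)
  qed
  finally show ?thesis by simp
qed

lemma tendsto_dyadic_floor: "(\<lambda>k. dyadic_floor k q) \<longlonglongrightarrow> (q::'a::euclidean_space)"
proof (rule LIM_zero_cancel, rule Lim_null_comparison)
  show "\<forall>\<^sub>F k in sequentially. norm (dyadic_floor k q - q) \<le> DIM('a) * (1/2) ^ k"
  proof (intro always_eventually allI)
    fix k
    have "norm (dyadic_floor k q - q) \<le> DIM('a) / 2 ^ k"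
      using norm_diff_dyadic_floor[of q k] by (simp only: norm_minus_commute)
    then show "norm (dyadic_floor k q - q) \<le> DIM('a) * (1/2) ^ k"
      by (simp add: power_one_over)
  qed
  show "(\<lambda>k. real DIM('a) * (1/2) ^ k) \<longlonglongrightarrow> 0"
    by (intro tendsto_mult_right_zero LIMSEQ_power_zero) auto
qed

text \<open>The part of the lattice of mesh \<open>1 / 2 ^ k\<close> in a cube of half side
  \<open>N\<close>, written as an image of integer coordinate functions so that it can be counted by
  \<open>card_PiE\<close>.\<close>

definition dyadic_grid :: "nat \<Rightarrow> nat \<Rightarrow> 'a::euclidean_space set" where
  "dyadic_grid N k = (\<lambda>c. \<Sum>b\<in>Basis. (of_int (c b) / 2 ^ k) *\<^sub>R b) ` (Basis \<rightarrow>\<^sub>E {- int (N * 2 ^ k)..int (N * 2 ^ k)})"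

lemma finite_dyadic_grid: "finite (dyadic_grid N k)"
  unfolding dyadic_grid_def by (intro finite_imageI finite_PiE) auto

lemma card_dyadic_grid:
  "card (dyadic_grid N k :: 'a::euclidean_space set) \<le> (2 * (N * 2 ^ k) + 1) ^ DIM('a)"
proof -
  have "card (dyadic_grid N k :: 'a set) \<le> card ((Basis::'a set) \<rightarrow>\<^sub>E {- int (N * 2 ^ k)..int (N * 2 ^ k)})"
    unfolding dyadic_grid_def by (intro card_image_le finite_PiE) auto
  also have "\<dots> = (2 * (N * 2 ^ k) + 1) ^ DIM('a)"
    by (subst card_PiE) (auto simp: nat_add_distrib nat_mult_distrib nat_power_eq)
  finally show ?thesis .
qed

lemma dyadic_floor_in_grid:
  assumes "\<And>b. b \<in> Basis \<Longrightarrow> \<bar>q \<bullet> b\<bar> \<le> real N"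
  shows "dyadic_floor k q \<in> dyadic_grid N k"
  unfolding dyadic_floor_def dyadic_grid_def
proof (rule image_eqI[of _ _ "restrict (\<lambda>b. \<lfloor>2 ^ k * (q \<bullet> b)\<rfloor>) Basis"])
  show "restrict (\<lambda>b. \<lfloor>2 ^ k * (q \<bullet> b)\<rfloor>) Basis \<in> Basis \<rightarrow>\<^sub>E {- int (N * 2 ^ k)..int (N * 2 ^ k)}"
  proof (auto simp del: of_nat_mult of_nat_power)
    fix b :: 'a assume "b \<in> Basis"
    then have *: "\<bar>q \<bullet> b\<bar> \<le> real N" by (rule assms)
    then have "2 ^ k * (- real N) \<le> 2 ^ k * (q \<bullet> b)" "2 ^ k * (q \<bullet> b) \<le> 2 ^ k * real N"
      by (intro mult_left_mono; simp)+
    then have "- real (N * 2 ^ k) \<le> 2 ^ k * (q \<bullet> b)" "2 ^ k * (q \<bullet> b) \<le> real (N * 2 ^ k)"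
      by (simp_all add: mult.commute)
    then show "- int (N * 2 ^ k) \<le> \<lfloor>2 ^ k * (q \<bullet> b)\<rfloor>" "\<lfloor>2 ^ k * (q \<bullet> b)\<rfloor> \<le> int (N * 2 ^ k)"
      by linarith+
  qed
qed auto

text \<open>Completing the square in \<open>m\<close>: a Gaussian factor beats exponential growth at
  every rate, with a bound independent of \<open>m\<close>.\<close>

lemma power_exp_square_le:
  fixes B \<kappa> :: real
  assumes "B > 0" "\<kappa> > 0"
  shows "B ^ m * exp (- \<kappa> * (real m)\<^sup>2) \<le> exp ((ln B)\<^sup>2 / (4 * \<kappa>))"
proof -
  have "0 \<le> (ln B - 2 * \<kappa> * m)\<^sup>2" by simp
  then have "(m * ln B - \<kappa> * (real m)\<^sup>2) * (4 * \<kappa>) \<le> (ln B)\<^sup>2"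
    by (simp add: power2_eq_square algebra_simps)
  then have "m * ln B - \<kappa> * (real m)\<^sup>2 \<le> (ln B)\<^sup>2 / (4 * \<kappa>)"
    using assms by (simp add: pos_le_divide_eq)
  moreover have "B ^ m = exp (m * ln B)" using assms by (simp add: exp_of_nat_mult)
  ultimately show ?thesis by (simp add: exp_add[symmetric])
qed

text \<open>A link from level \<open>k\<close> to \<open>k + 1\<close> is allowed the size
  \<open>\<delta> * (n + k) * \<theta> ^ k\<close>. The factor \<open>\<theta> ^ k\<close> matches
  its standard deviation, and \<open>n + k\<close> produces the exponent \<open>(n + k)^2\<close>
  that beats the exponential number of links, while the allowances still add up to a multiple of
  \<open>n\<close>. The bound \<open>w\<close> in the tail of increments is positive, so coinciding
  points cause no division by zero.\<close>

lemma (in prob_space) chaining_bound: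
  fixes Z :: "nat \<Rightarrow> 'b::euclidean_space \<Rightarrow> 'a \<Rightarrow> real" and \<epsilon> :: real
  assumes meas [measurable]: "\<And>n q. 1 \<le> n \<Longrightarrow> q \<in> S \<Longrightarrow> Z n q \<in> borel_measurable M"
    and cont: "\<And>n \<omega>. 1 \<le> n \<Longrightarrow> \<omega> \<in> space M \<Longrightarrow> continuous_on S (\<lambda>q. Z n q \<omega>)"
    and S: "\<And>k q. q \<in> S \<Longrightarrow> dyadic_floor k q \<in> S"
    and p: "0 < p" and v: "0 < v"
    and tail: "\<And>n q a. 1 \<le> n \<Longrightarrow> q \<in> S \<Longrightarrow> 0 < a \<Longrightarrow>
       prob {\<omega> \<in> space M. a \<le> \<bar>Z n q \<omega>\<bar>} \<le> 2 * exp (- a\<^sup>2 / v)"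
    and tail': "\<And>n q q' a w. 1 \<le> n \<Longrightarrow> q \<in> S \<Longrightarrow> q' \<in> S \<Longrightarrow> 0 < a \<Longrightarrow> 0 < w \<Longrightarrow> norm (q - q') powr p \<le> w \<Longrightarrow>
       prob {\<omega> \<in> space M. a \<le> \<bar>Z n q \<omega> - Z n q' \<omega>\<bar>} \<le> 2 * exp (- a\<^sup>2 / (v * w))"
    and \<epsilon>: "0 < \<epsilon>"
  shows "AE \<omega> in M. \<forall>\<^sub>F n in sequentially.
     \<forall>q\<in>S. (\<forall>b\<in>Basis. \<bar>q \<bullet> b\<bar> \<le> real (R * 2 ^ n)) \<longrightarrow> \<bar>Z n q \<omega>\<bar> \<le> \<epsilon> * n"
proof -
  let ?d = "DIM('b)"
  \<comment> \<open>Halving a distance multiplies the variance bound by \<open>\<theta>^2\<close>,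
    hence the standard deviation by \<open>\<theta>\<close>.\<close>
  define \<theta> where "\<theta> = 2 powr (- p / 2)"
  have \<theta>: "0 < \<theta>" "\<theta> < 1"
    using p powr_less_mono[of "-p/2" 0 2] by (auto simp: \<theta>_def)
  \<comment> \<open>The total allowance of the links in units of \<open>\<delta> * n\<close>, after
    \<open>n + k\<close> is replaced by \<open>n * (k + 1)\<close>.\<close>
  define \<Theta> where "\<Theta> = (\<Sum>k. of_nat (Suc k) * \<theta> ^ k)"
  have sums: "(\<lambda>k. of_nat (Suc k) * \<theta> ^ k) sums \<Theta>"
    using geometric_deriv_sums[of \<theta>] \<theta> unfolding \<Theta>_def by (auto simp: sums_iff)
  have \<Theta>: "(\<Sum>k<K. of_nat (Suc k) * \<theta> ^ k) \<le> \<Theta>" for K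
    unfolding \<Theta>_def by (rule sum_le_suminf) (use sums \<theta> in \<open>auto simp: sums_iff\<close>)
  have \<Theta>0: "0 \<le> \<Theta>" using \<Theta>[of 0] by simp
  \<comment> \<open>The tolerance is shared between the coarsest point (the 1) and all links (the
    \<open>\<Theta>\<close>).\<close>
  define \<delta> where "\<delta> = \<epsilon> / (1 + \<Theta>)"
  have \<delta>: "\<delta> > 0" "\<delta> * (1 + \<Theta>) = \<epsilon>" using \<epsilon> \<Theta>0 by (auto simp: \<delta>_def)
  define c where "c = (2 * real ?d) powr p"
  have c: "c > 0" using DIM_positive[where 'a='b] by (simp add: c_def)
  \<comment> \<open>The smaller of the Gaussian rates for links and for coarsest points.\<close>
  define \<kappa> where "\<kappa> = min (\<delta>\<^sup>2 / (v * c)) (\<delta>\<^sup>2 / v)"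
  have \<kappa>: "\<kappa> > 0" using \<delta> v c by (simp add: \<kappa>_def)
  define G where "G n k = (dyadic_grid (R * 2 ^ n) k \<inter> S :: 'b set)" for n k
  have finG: "finite (G n k)" and subG: "G n k \<subseteq> S" for n k
    by (auto simp: G_def finite_dyadic_grid)
  define A where "A = 2 * real R + 1"
  have A1: "A \<ge> 1" by (simp add: A_def)
  have cardG: "real (card (G n k)) \<le> (A * 2 ^ (n + k)) ^ ?d" for n k
  proof -
    have "card (G n k) \<le> card (dyadic_grid (R * 2 ^ n) k :: 'b set)"
      unfolding G_def by (intro card_mono finite_dyadic_grid) auto
    also have "\<dots> \<le> (2 * (R * 2 ^ n * 2 ^ k) + 1) ^ ?d" by (rule card_dyadic_grid)
    finally have "real (card (G n k)) \<le> real ((2 * (R * 2 ^ n * 2 ^ k) + 1) ^ ?d)" by (simp only: of_nat_le_iff)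
    also have "\<dots> = (2 * (real R * 2 ^ n * 2 ^ k) + 1) ^ ?d" by (simp add: add.commute)
    also have "\<dots> \<le> (A * 2 ^ (n + k)) ^ ?d"
    proof (rule power_mono)
      have "(1::real) \<le> 2 ^ (n + k)" by simp
      then show "2 * (real R * 2 ^ n * 2 ^ k) + 1 \<le> A * 2 ^ (n + k)"
        by (simp add: A_def algebra_simps power_add)
    qed auto
    finally show ?thesis .
  qed
  \<comment> \<open>A finite set of pairs that contains the link of every \<open>q\<close> in the
    cube, so the union bound runs over \<open>E n k\<close> instead of over
    \<open>q\<close>.\<close>
  define E where "E n k = {e \<in> G n k \<times> G n (Suc k). norm (fst e - snd e) \<le> 2 * real ?d / 2 ^ k}" for n k
  have finE: "finite (E n k)" for n k unfolding E_def using finG by auto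
  define A' where "A' = (2 * A) ^ (2 * ?d)"
  define B where "B = (2::real) ^ (2 * ?d)"
  have A'1: "A' \<ge> 1" using A1 unfolding A'_def by (intro one_le_power) auto
  have B1: "B \<ge> 1" unfolding B_def by simp
  have cardE: "real (card (E n k)) \<le> A' * B ^ (n + k)" for n k
  proof -
    have "card (E n k) \<le> card (G n k \<times> G n (Suc k))" unfolding E_def using finG by (intro card_mono) auto
    then have "real (card (E n k)) \<le> real (card (G n k)) * real (card (G n (Suc k)))"
      by (simp add: card_cartesian_product flip: of_nat_mult)
    also have "\<dots> \<le> (A * 2 ^ (n + Suc k)) ^ ?d * (A * 2 ^ (n + Suc k)) ^ ?d"
    proof (intro mult_mono cardG)
      show "real (card (G n k)) \<le> (A * 2 ^ (n + Suc k)) ^ ?d"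
        by (rule order_trans[OF cardG]) (use A1 in \<open>intro power_mono mult_left_mono, auto\<close>)
    qed (use A1 in auto)
    also have "\<dots> = (2 * A * 2 ^ (n + k)) ^ (2 * ?d)"
      unfolding mult_2[of ?d] power_add[of _ ?d ?d] by (simp add: ac_simps)
    also have "\<dots> = A' * B ^ (n + k)"
      unfolding A'_def B_def power_mult_distrib[of "2 * A"] by (simp only: mult.commute flip: power_mult)
    finally show ?thesis .
  qed
  have cardG0: "real (card (G n 0)) \<le> A' * B ^ n" for n
  proof -
    have "real (card (G n 0)) \<le> (A * 2 ^ n) ^ ?d" using cardG[of n 0] by simp
    also have "\<dots> \<le> (2 * A * 2 ^ n) ^ (2 * ?d)"
    proof (rule order_trans)
      show "(A * 2 ^ n) ^ ?d \<le> (2 * A * 2 ^ n) ^ ?d" using A1 by (intro power_mono) auto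
      have "1 \<le> 2 * A * 2 ^ n" using A1 by (metis (no_types) mult_mono one_le_numeral one_le_power mult_1 zero_le_one
           mult_ge1_I)
      then show "(2 * A * 2 ^ n) ^ ?d \<le> (2 * A * 2 ^ n) ^ (2 * ?d)" by (intro power_increasing) auto
    qed
    also have "\<dots> = A' * B ^ n" by (simp add: A'_def B_def power_mult_distrib mult.commute flip: power_mult)
    finally show ?thesis .
  qed
  \<comment> \<open>With \<open>4 * B\<close> instead of \<open>B\<close> a factor
    \<open>(1/4) ^ m\<close> is left over, which makes the probabilities summable over both
    \<open>n\<close> and \<open>k\<close>.\<close>
  define K where "K = 2 * A' * exp ((ln (4 * B))\<^sup>2 / (4 * \<kappa>))"
  have K0: "K \<ge> 0" using A'1 by (simp add: K_def)
  have bound: "N * (2 * exp (- t)) \<le> K * (1/4) ^ m"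
    if "N \<le> A' * B ^ m" "\<kappa> * (real m)\<^sup>2 \<le> t" for N t m
  proof -
    have "N * (2 * exp (- t)) \<le> (A' * B ^ m) * (2 * exp (- \<kappa> * (real m)\<^sup>2))"
      by (intro mult_mono) (use that A'1 B1 in auto)
    also have "\<dots> = 2 * A' * ((4 * B) ^ m * exp (- \<kappa> * (real m)\<^sup>2)) * (1/4) ^ m"
      by (simp add: power_mult_distrib power_one_over)
    also have "\<dots> \<le> 2 * A' * exp ((ln (4 * B))\<^sup>2 / (4 * \<kappa>)) * (1/4) ^ m"
      using A'1 B1 \<kappa> by (intro mult_right_mono mult_left_mono power_exp_square_le) auto
    finally show ?thesis by (simp add: K_def)
  qed
  \<comment> \<open>The bad events: some link at level \<open>k\<close> exceeds its allowance, or,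
    for \<open>F0\<close>, some coarsest point does.\<close>
  define F where "F n k = (\<Union>e\<in>E n k. {\<omega> \<in> space M. \<delta> * real (n + k) * \<theta> ^ k \<le> \<bar>Z n (fst e) \<omega> - Z n (snd e) \<omega>\<bar>})" for n k
  define F0 where "F0 n = (\<Union>g\<in>G n 0. {\<omega> \<in> space M. \<delta> * n \<le> \<bar>Z n g \<omega>\<bar>})" for n
  have ES: "fst e \<in> S" "snd e \<in> S" if "e \<in> E n k" for e n k
    using that subG[of n k] subG[of n "Suc k"] unfolding E_def by auto
  have F_meas: "F n k \<in> sets M" if "1 \<le> n" for n k
  proof -
    have "{\<omega> \<in> space M. \<delta> * real (n + k) * \<theta> ^ k \<le> \<bar>Z n (fst e) \<omega> - Z n (snd e) \<omega>\<bar>} \<in> sets M" if "e \<in> E n k" for e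
      using meas[OF \<open>1 \<le> n\<close> ES(1)[OF that]] meas[OF \<open>1 \<le> n\<close> ES(2)[OF that]] by measurable
    then show ?thesis unfolding F_def by (intro sets.finite_UN finE) auto
  qed
  have F0_meas: "F0 n \<in> sets M" if "1 \<le> n" for n
  proof -
    have "{\<omega> \<in> space M. \<delta> * n \<le> \<bar>Z n g \<omega>\<bar>} \<in> sets M" if "g \<in> G n 0" for g
    proof -
      have [measurable]: "Z n g \<in> borel_measurable M"
        by (rule meas[OF \<open>1 \<le> n\<close>]) (use subG[of n 0] that in auto)
      show ?thesis by measurable
    qed
    then show ?thesis unfolding F0_def by (intro sets.finite_UN finG) auto
  qed
  have F_prob: "prob (F n k) \<le> K * (1/4) ^ (n + k)" if n: "1 \<le> n" for n k
  proof -
    let ?a = "\<delta> * real (n + k) * \<theta> ^ k"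
    let ?w = "c * (\<theta> ^ k)\<^sup>2"
    let ?t = "?a\<^sup>2 / (v * ?w)"
    have a: "?a > 0" and w: "?w > 0" using \<delta> \<theta> n c by auto
    have "prob (F n k) \<le> (\<Sum>e\<in>E n k. prob {\<omega> \<in> space M. ?a \<le> \<bar>Z n (fst e) \<omega> - Z n (snd e) \<omega>\<bar>})"
      unfolding F_def
    proof (intro finite_measure_subadditive_finite finE image_subsetI)
      fix e assume "e \<in> E n k"
      then show "{\<omega> \<in> space M. ?a \<le> \<bar>Z n (fst e) \<omega> - Z n (snd e) \<omega>\<bar>} \<in> sets M"
        using meas[OF n ES(1)] meas[OF n ES(2)] by measurable
    qed
    also have "\<dots> \<le> (\<Sum>e\<in>E n k. 2 * exp (- ?t))"
    proof (rule sum_mono)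
      fix e assume e: "e \<in> E n k"
      have "norm (fst e - snd e) powr p \<le> (2 * real ?d / 2 ^ k) powr p"
        using e p by (intro powr_mono2) (auto simp: E_def)
      also have "\<dots> = c * (\<theta> ^ k)\<^sup>2"
      proof -
        have "(2 ^ k) powr p = 1 / (\<theta> ^ k)\<^sup>2"
          by (simp add: \<theta>_def powr_realpow[symmetric] powr_powr powr_minus field_simps flip: powr_add)
        then show ?thesis by (simp add: c_def powr_divide)
      qed
      finally show "prob {\<omega> \<in> space M. ?a \<le> \<bar>Z n (fst e) \<omega> - Z n (snd e) \<omega>\<bar>} \<le> 2 * exp (- ?t)"
        using tail'[OF n ES[OF e] a w] by simp
    qed
    also have "\<dots> = real (card (E n k)) * (2 * exp (- ?t))" by simp
    also have "\<dots> \<le> K * (1/4) ^ (n + k)"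
    proof (rule bound[OF cardE])
      \<comment> \<open>The powers of \<open>\<theta>\<close> cancel, since the allowance and the
        standard deviation of a link shrink together.\<close>
      have "?t = \<delta>\<^sup>2 / (v * c) * (real (n + k))\<^sup>2"
        using \<theta> by (simp add: power_mult_distrib)
      then show "\<kappa> * (real (n + k))\<^sup>2 \<le> ?t" by (simp only:, intro mult_right_mono) (auto simp: \<kappa>_def)
    qed
    finally show ?thesis .
  qed
  have F0_prob: "prob (F0 n) \<le> K * (1/4) ^ n" if n: "1 \<le> n" for n
  proof -
    let ?t = "(\<delta> * n)\<^sup>2 / v"
    have a: "\<delta> * n > 0" using \<delta> n by auto
    have "prob (F0 n) \<le> (\<Sum>g\<in>G n 0. prob {\<omega> \<in> space M. \<delta> * n \<le> \<bar>Z n g \<omega>\<bar>})"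
      unfolding F0_def
    proof (intro finite_measure_subadditive_finite finG image_subsetI)
      fix g assume "g \<in> G n 0"
      then have [measurable]: "Z n g \<in> borel_measurable M"
        by (intro meas[OF n]) (use subG[of n 0] in auto)
      show "{\<omega> \<in> space M. \<delta> * n \<le> \<bar>Z n g \<omega>\<bar>} \<in> sets M" by measurable
    qed
    also have "\<dots> \<le> (\<Sum>g\<in>G n 0. 2 * exp (- ?t))"
      using tail[OF n _ a] subG[of n 0] by (intro sum_mono) auto
    also have "\<dots> = real (card (G n 0)) * (2 * exp (- ?t))" by simp
    also have "\<dots> \<le> K * (1/4) ^ n"
    proof (rule bound[OF cardG0])
      have "?t = \<delta>\<^sup>2 / v * (real n)\<^sup>2" by (simp add: power_mult_distrib)
      then show "\<kappa> * (real n)\<^sup>2 \<le> ?t" by (simp only:, intro mult_right_mono) (auto simp: \<kappa>_def)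
    qed
    finally show ?thesis .
  qed
  \<comment> \<open>The estimates hold from \<open>n = 1\<close> on, whereas Borel--Cantelli is
    applied to a sequence starting at 0; the shift is undone below by passing to
    \<open>H (n - 1)\<close>.\<close>
  define H where "H n = F0 (Suc n) \<union> (\<Union>k. F (Suc n) k)" for n
  have H_meas: "H n \<in> sets M" for n unfolding H_def using F_meas F0_meas by auto
  have H_prob: "prob (H n) \<le> 3 * K * (1/4) ^ Suc n" for n
  proof -
    have s: "(\<lambda>k. K * (1/4) ^ (Suc n + k)) sums (K * (1/4) ^ Suc n * (1 / (1 - 1/4)))"
      unfolding power_add mult.assoc[symmetric] by (intro sums_mult geometric_sums) auto
    have sm: "summable (\<lambda>k. prob (F (Suc n) k))"
    proof (rule summable_comparison_test'[OF sums_summable[OF s]])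
      show "norm (prob (F (Suc n) k)) \<le> K * (1/4) ^ (Suc n + k)" for k
        using F_prob[of "Suc n" k] by (simp del: power_Suc add_Suc)
    qed
    have "prob (\<Union>k. F (Suc n) k) \<le> (\<Sum>k. prob (F (Suc n) k))"
      by (intro finite_measure_subadditive_countably sm) (use F_meas in auto)
    also have "\<dots> \<le> (\<Sum>k. K * (1/4) ^ (Suc n + k))"
      by (intro suminf_le sm sums_summable[OF s] F_prob) auto
    also have "\<dots> = K * (1/4) ^ Suc n * (4/3)" using s by (simp add: sums_iff)
    also have "\<dots> \<le> K * (1/4) ^ Suc n * 2" using K0 by (intro mult_left_mono) auto
    finally have "prob (\<Union>k. F (Suc n) k) \<le> 2 * K * (1/4) ^ Suc n" by simp
    moreover have "prob (H n) \<le> prob (F0 (Suc n)) + prob (\<Union>k. F (Suc n) k)"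
      unfolding H_def by (intro measure_Un_le) (use F_meas F0_meas in auto)
    moreover have "prob (F0 (Suc n)) \<le> K * (1/4) ^ Suc n" by (rule F0_prob) simp
    ultimately show ?thesis by simp
  qed
  have "summable (\<lambda>n. prob (H n))"
  proof (rule summable_comparison_test')
    show "summable (\<lambda>n. 3 * K * (1/4) ^ Suc n)" by (simp add: summable_mult summable_geometric)
    show "norm (prob (H n)) \<le> 3 * K * (1/4) ^ Suc n" for n
      using H_prob[of n] by (simp del: power_Suc)
  qed
  then have "AE \<omega> in M. \<forall>\<^sub>F n in sequentially. \<omega> \<in> space M - H n"
    by (intro borel_cantelli_AE1) (auto simp: H_meas less_top[symmetric])
  then show ?thesis
  proof (eventually_elim)
    case (elim \<omega>)
    then have "\<forall>\<^sub>F n in sequentially. \<omega> \<in> space M - H (n - 1)"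
      by (rule eventually_compose_filterlim[OF _ filterlim_minus_const_nat_at_top])
    then show ?case using eventually_ge_at_top[of 1]
    proof eventually_elim
      case (elim n)
      then have n: "1 \<le> n" and \<omega>: "\<omega> \<in> space M" and notH: "\<omega> \<notin> F0 n" "\<And>k. \<omega> \<notin> F n k"
        by (auto simp: H_def)
      show ?case
      proof (intro ballI impI)
        fix q assume q: "q \<in> S" "\<forall>b\<in>Basis. \<bar>q \<bullet> b\<bar> \<le> real (R * 2 ^ n)"
        let ?q = "\<lambda>k. dyadic_floor k q"
        have qG: "?q k \<in> G n k" for k
          unfolding G_def using S q dyadic_floor_in_grid[of q "R * 2 ^ n" k] by auto
        have qE: "(?q k, ?q (Suc k)) \<in> E n k" for k
        proof -
          have "norm (?q k - ?q (Suc k)) = norm ((q - ?q (Suc k)) - (q - ?q k))" by (simp add: algebra_simps)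
          also have "\<dots> \<le> ?d / 2 ^ Suc k + ?d / 2 ^ k"
            by (rule order_trans[OF norm_triangle_ineq4 add_mono[OF norm_diff_dyadic_floor norm_diff_dyadic_floor]])
          also have "\<dots> \<le> 2 * real ?d / 2 ^ k" by (simp add: field_simps)
          finally show ?thesis using qG by (simp add: E_def)
        qed
        have step: "\<bar>Z n (?q k) \<omega> - Z n (?q (Suc k)) \<omega>\<bar> \<le> \<delta> * n * (of_nat (Suc k) * \<theta> ^ k)" for k
        proof -
          have "\<bar>Z n (?q k) \<omega> - Z n (?q (Suc k)) \<omega>\<bar> \<le> \<delta> * real (n + k) * \<theta> ^ k"
            using notH(2)[of k] qE[of k] \<omega> unfolding F_def by (force simp: not_le)
          \<comment> \<open>This splits off the factor \<open>n\<close>, leaving a series that does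
            not depend on \<open>n\<close>.\<close>
          also have "\<dots> \<le> \<delta> * (real n * real (Suc k)) * \<theta> ^ k"
          proof (intro mult_right_mono mult_left_mono)
            have "real k \<le> real n * real k" using n by (simp add: mult_le_cancel_right1)
            then show "real (n + k) \<le> real n * real (Suc k)" by (simp add: algebra_simps)
          qed (use \<delta> \<theta> in auto)
          finally show ?thesis by (simp add: ac_simps)
        qed
        have "\<bar>Z n (?q k) \<omega>\<bar> \<le> \<delta> * n * (1 + (\<Sum>j<k. of_nat (Suc j) * \<theta> ^ j))" for k
        proof (induction k)
          case 0
          then show ?case using notH(1) qG[of 0] \<omega> unfolding F0_def by (force simp: not_le)
        next
          case (Suc k)
          then show ?case using step[of k] by (simp add: algebra_simps)
        qed
        also have "\<delta> * n * (1 + (\<Sum>j<k. of_nat (Suc j) * \<theta> ^ j)) \<le> \<epsilon> * n" for k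
        proof -
          have "\<delta> * n * (1 + (\<Sum>j<k. of_nat (Suc j) * \<theta> ^ j)) \<le> \<delta> * n * (1 + \<Theta>)"
            using \<Theta>[of k] \<delta>(1) by (intro mult_left_mono) auto
          also have "\<dots> = \<epsilon> * n" by (simp add: \<delta>(2)[symmetric])
          finally show ?thesis .
        qed
        finally have le: "\<bar>Z n (?q k) \<omega>\<bar> \<le> \<epsilon> * n" for k .
        \<comment> \<open>Continuity extends the bound from dyadic points to every \<open>q\<close>
          for the same \<open>\<omega>\<close>, without a new null set.\<close>
        have "(\<lambda>k. Z n (?q k) \<omega>) \<longlonglongrightarrow> Z n q \<omega>"
          using continuous_on_tendsto_compose[OF cont[OF n \<omega>] tendsto_dyadic_floor q(1)] S[OF q(1)] by auto
        then show "\<bar>Z n q \<omega>\<bar> \<le> \<epsilon> * n"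
          by (intro tendsto_upperbound[OF tendsto_rabs]) (use le in auto)
      qed
    qed
  qed
qed

section \<open>The mollified fields\<close>

definition test_functions :: "('a::euclidean_space \<Rightarrow> real) set" where
  "test_functions = {f. smooth f \<and> (\<exists>R. \<forall>x. R < norm x \<longrightarrow> f x = 0) \<and> integrable lborel f}"

lemma test_functions_schwartz: "f \<in> test_functions \<Longrightarrow> f \<in> schwartz"
  using smooth_compact_support_schwartz by (auto simp: test_functions_def)

lemma test_functions_diff:
  assumes "f \<in> test_functions" "g \<in> test_functions"
  shows "(\<lambda>x. f x - g x) \<in> test_functions"
proof -
  obtain R S where "\<And>x. R < norm x \<Longrightarrow> f x = 0" "\<And>x. S < norm x \<Longrightarrow> g x = 0"
    using assms by (auto simp: test_functions_def)
  then have "\<forall>x. max R S < norm x \<longrightarrow> f x - g x = 0" by simp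
  moreover have "smooth (\<lambda>x. f x - g x)" "integrable lborel (\<lambda>x. f x - g x)"
    using assms smooth_diff by (auto simp: test_functions_def)
  ultimately show ?thesis unfolding test_functions_def by blast
qed

lemma measure_convolution_test_function:
  assumes \<psi>: "bump_kernel \<psi>" and n: "0 < n" and \<rho>: "admissible_mollifier \<rho>" and \<epsilon>: "0 < \<epsilon>" "1 \<le> n * \<epsilon>"
  shows "measure_convolution (rescaled \<rho> z \<epsilon>) (bump_scaled \<psi> n) \<in> test_functions"
proof -
  have "measure_convolution (rescaled \<rho> z \<epsilon>) (bump_scaled \<psi> n) x = 0" if "2 * \<epsilon> + norm z < norm x" for x
    using measure_convolution_rescaled_eq_0[OF assms, of x z] norm_triangle_ineq2[of x z] that by simp
  then show ?thesis unfolding test_functions_def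
    using measure_convolution_bump[OF \<psi> n rescaled_prob_space[OF \<rho>]] by blast
qed

text \<open>Unlike \<open>is_pairing\<close> this also covers differences of pairings, at one point
  or at two, and it names the approximating test functions, to which linearity and Gaussianity of
  \<open>h\<close> apply.\<close>

definition L2_approximated ::
    "'w measure \<Rightarrow> ('w \<Rightarrow> ('a::euclidean_space \<Rightarrow> real) \<Rightarrow> real) \<Rightarrow> ('w \<Rightarrow> real) \<Rightarrow> (nat \<Rightarrow> 'a \<Rightarrow> real) \<Rightarrow> bool" where
  "L2_approximated M h Z F \<longleftrightarrow> Z \<in> borel_measurable M \<and> (\<forall>n. F n \<in> test_functions) \<and>
     (\<lambda>n. \<integral>\<^sup>+ \<omega>. ennreal ((h \<omega> (F n) - Z \<omega>)\<^sup>2) \<partial>M) \<longlonglongrightarrow> 0"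

text \<open>The index is shifted by \<open>N\<close> because the first bumps are wider than
  \<open>\<epsilon>\<close>; an initial segment does not affect the limit.\<close>

lemma L2_approximated_pairing:
  assumes \<psi>: "bump_kernel \<psi>" and \<rho>: "admissible_mollifier \<rho>" and \<epsilon>: "0 < \<epsilon>" "1 \<le> real N * \<epsilon>"
    and Y: "is_pairing M \<psi> h (rescaled \<rho> z \<epsilon>) Y"
  shows "L2_approximated M h Y (\<lambda>n. measure_convolution (rescaled \<rho> z \<epsilon>) (bump_scaled \<psi> (n + N)))"
  unfolding L2_approximated_def
proof (intro conjI allI)
  show "Y \<in> borel_measurable M" using Y by (simp add: is_pairing_def)
  fix n
  have "real N * \<epsilon> \<le> real (n + N) * \<epsilon>" using \<epsilon> by (intro mult_right_mono) auto
  then have "1 \<le> real (n + N) * \<epsilon>" using \<epsilon> by linarith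
  moreover have "0 < N" using \<epsilon> by (cases N) auto
  ultimately show "measure_convolution (rescaled \<rho> z \<epsilon>) (bump_scaled \<psi> (n + N)) \<in> test_functions"
    using \<epsilon> by (intro measure_convolution_test_function[OF \<psi> _ \<rho>]) auto
next
  show "(\<lambda>n. \<integral>\<^sup>+ \<omega>. ennreal ((h \<omega> (measure_convolution (rescaled \<rho> z \<epsilon>) (bump_scaled \<psi> (n + N))) - Y \<omega>)\<^sup>2) \<partial>M) \<longlonglongrightarrow> 0"
    using Y unfolding is_pairing_def by (intro LIMSEQ_ignore_initial_segment) auto
qed

lemma ennreal_power2_sum_le:
  fixes a b c :: real
  assumes "\<bar>c\<bar> \<le> \<bar>a\<bar> + \<bar>b\<bar>"
  shows "ennreal (c\<^sup>2) \<le> 2 * ennreal (a\<^sup>2) + 2 * ennreal (b\<^sup>2)"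
proof -
  have "c\<^sup>2 \<le> (\<bar>a\<bar> + \<bar>b\<bar>)\<^sup>2" using power_mono[OF assms, of 2] by simp
  also have "\<dots> \<le> 2 * a\<^sup>2 + 2 * b\<^sup>2"
    using sum_squares_bound[of "\<bar>a\<bar>" "\<bar>b\<bar>"] by (simp add: power2_sum)
  finally have "ennreal (c\<^sup>2) \<le> ennreal (2 * a\<^sup>2 + 2 * b\<^sup>2)" by (rule ennreal_leI)
  then show ?thesis by (simp add: ennreal_plus ennreal_mult')
qed

lemma nn_integral_power2_diff_le:
  fixes f g f' g' :: "'w \<Rightarrow> real"
  assumes [measurable]: "f \<in> borel_measurable M" "g \<in> borel_measurable M" "f' \<in> borel_measurable M" "g' \<in> borel_measurable M"
  shows "(\<integral>\<^sup>+ \<omega>. ennreal (((f \<omega> - f' \<omega>) - (g \<omega> - g' \<omega>))\<^sup>2) \<partial>M)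
    \<le> 2 * (\<integral>\<^sup>+ \<omega>. ennreal ((f \<omega> - g \<omega>)\<^sup>2) \<partial>M) + 2 * (\<integral>\<^sup>+ \<omega>. ennreal ((f' \<omega> - g' \<omega>)\<^sup>2) \<partial>M)"
proof -
  have "(\<integral>\<^sup>+ \<omega>. ennreal (((f \<omega> - f' \<omega>) - (g \<omega> - g' \<omega>))\<^sup>2) \<partial>M)
    \<le> (\<integral>\<^sup>+ \<omega>. 2 * ennreal ((f \<omega> - g \<omega>)\<^sup>2) + 2 * ennreal ((f' \<omega> - g' \<omega>)\<^sup>2) \<partial>M)"
    by (intro nn_integral_mono ennreal_power2_sum_le) arith
  also have "\<dots> = 2 * (\<integral>\<^sup>+ \<omega>. ennreal ((f \<omega> - g \<omega>)\<^sup>2) \<partial>M) + 2 * (\<integral>\<^sup>+ \<omega>. ennreal ((f' \<omega> - g' \<omega>)\<^sup>2) \<partial>M)"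
    by (subst nn_integral_add) (auto simp: nn_integral_cmult)
  finally show ?thesis .
qed

lemma random_functional_diff:
  assumes "random_functional M schwartz h" "f \<in> test_functions" "g \<in> test_functions" "\<omega> \<in> space M"
  shows "h \<omega> (\<lambda>x. f x - g x) = h \<omega> f - h \<omega> g"
proof -
  have "h \<omega> (\<lambda>x. 1 * f x + (-1) * g x) = 1 * h \<omega> f + (-1) * h \<omega> g"
    using assms test_functions_schwartz unfolding random_functional_def continuous_functional_def by blast
  then show ?thesis by simp
qed

lemma L2_approximated_diff:
  assumes h: "random_functional M schwartz h"
    and Z: "L2_approximated M h Z F" and Z': "L2_approximated M h Z' F'"
  shows "L2_approximated M h (\<lambda>\<omega>. Z \<omega> - Z' \<omega>) (\<lambda>n x. F n x - F' n x)"
proof -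
  have F: "F n \<in> test_functions" "F' n \<in> test_functions" for n
    using Z Z' by (auto simp: L2_approximated_def)
  have [measurable]: "Z \<in> borel_measurable M" "Z' \<in> borel_measurable M"
    "(\<lambda>\<omega>. h \<omega> (F n)) \<in> borel_measurable M" "(\<lambda>\<omega>. h \<omega> (F' n)) \<in> borel_measurable M" for n
    using Z Z' h F[THEN test_functions_schwartz] by (auto simp: L2_approximated_def random_functional_def)
  let ?I = "\<lambda>Z F n. \<integral>\<^sup>+ \<omega>. ennreal ((h \<omega> (F n) - Z \<omega>)\<^sup>2) \<partial>M"
  have le: "?I (\<lambda>\<omega>. Z \<omega> - Z' \<omega>) (\<lambda>n x. F n x - F' n x) n \<le> 2 * ?I Z F n + 2 * ?I Z' F' n" for n
  proof -
    have "?I (\<lambda>\<omega>. Z \<omega> - Z' \<omega>) (\<lambda>n x. F n x - F' n x) n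
       = (\<integral>\<^sup>+ \<omega>. ennreal (((h \<omega> (F n) - h \<omega> (F' n)) - (Z \<omega> - Z' \<omega>))\<^sup>2) \<partial>M)"
      by (intro nn_integral_cong) (simp add: random_functional_diff[OF h F])
    then show ?thesis using nn_integral_power2_diff_le[of "\<lambda>\<omega>. h \<omega> (F n)" M Z "\<lambda>\<omega>. h \<omega> (F' n)" Z'] by simp
  qed
  have "(\<lambda>n. 2 * ?I Z F n + 2 * ?I Z' F' n) \<longlonglongrightarrow> 2 * 0 + 2 * 0"
    using Z Z' unfolding L2_approximated_def
    by (intro tendsto_add ennreal_tendsto_cmult) auto
  then have lim: "(\<lambda>n. 2 * ?I Z F n + 2 * ?I Z' F' n) \<longlonglongrightarrow> 0" by simp
  show ?thesis
    unfolding L2_approximated_def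
  proof (intro conjI allI)
    show "(\<lambda>n. ?I (\<lambda>\<omega>. Z \<omega> - Z' \<omega>) (\<lambda>n x. F n x - F' n x) n) \<longlonglongrightarrow> 0"
      by (rule tendsto_sandwich[OF _ _ tendsto_const lim]) (use le in auto)
  qed (use F test_functions_diff in auto)
qed

text \<open>Both 1 and 2 are multiples of \<open>1 / 2 ^ k\<close>, so rounding down cannot leave
  the interval between them.\<close>

lemma dyadic_floor_strip:
  assumes "q \<in> (UNIV :: 'a::euclidean_space set) \<times> {1..2::real}"
  shows "dyadic_floor k q \<in> UNIV \<times> {1..2}"
proof -
  have "snd (dyadic_floor k q) = dyadic_floor k q \<bullet> (0, 1)" by (simp add: inner_prod_def)
  also have "\<dots> = of_int \<lfloor>2 ^ k * (q \<bullet> (0, 1))\<rfloor> / 2 ^ k"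
    by (rule dyadic_floor_inner_Basis) (simp add: Basis_prod_def)
  also have "q \<bullet> (0, 1) = snd q" by (simp add: inner_prod_def)
  finally have snd: "snd (dyadic_floor k q) = of_int \<lfloor>2 ^ k * snd q\<rfloor> / 2 ^ k" .
  have q: "1 \<le> snd q" "snd q \<le> 2" using assms by (auto simp: mem_Times_iff)
  have "(2::real) ^ k * 1 \<le> 2 ^ k * snd q" using q by (intro mult_left_mono) auto
  then have "(2::int) ^ k \<le> \<lfloor>2 ^ k * snd q\<rfloor>" by (simp add: le_floor_iff)
  then have 1: "(2::real) ^ k \<le> of_int \<lfloor>2 ^ k * snd q\<rfloor>" by (metis of_int_le_iff of_int_numeral of_int_power)
  have "(2::real) ^ k * snd q \<le> 2 ^ k * 2" using q by (intro mult_left_mono) auto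
  then have 2: "of_int \<lfloor>2 ^ k * snd q\<rfloor> \<le> (2::real) ^ k * 2" by linarith
  show ?thesis using 1 2 by (simp add: mem_Times_iff snd field_simps)
qed

text \<open>Take the least \<open>n\<close> with \<open>1 / \<epsilon> \<le> 2 ^ n\<close>;
  minimality gives the upper bounds. The last property makes \<open>n\<close> large when
  \<open>\<epsilon>\<close> is small.\<close>

lemma dyadic_scale:
  fixes \<epsilon> :: real
  assumes "0 < \<epsilon>" "\<epsilon> < 1"
  obtains n :: nat where "1 \<le> 2 ^ n * \<epsilon>" "2 ^ n * \<epsilon> \<le> 2" "1 \<le> n" "(real n - 1) * ln 2 \<le> ln (1 / \<epsilon>)"
    "\<And>m. \<epsilon> < 1 / 2 ^ m \<Longrightarrow> m < n"
proof -
  have ex: "\<exists>n::nat. 1 / \<epsilon> \<le> 2 ^ n" using real_arch_pow[of 2 "1/\<epsilon>"] by (auto intro: less_imp_le)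
  define n where "n = (LEAST n::nat. 1 / \<epsilon> \<le> 2 ^ n)"
  have n1: "1 / \<epsilon> \<le> 2 ^ n" unfolding n_def by (rule LeastI_ex[OF ex])
  have n0: "n \<noteq> 0" using n1 assms by (cases n) auto
  then have "\<not> 1 / \<epsilon> \<le> 2 ^ (n - 1)" unfolding n_def by (intro not_less_Least) auto
  then have n2: "2 ^ (n - 1) < 1 / \<epsilon>" by simp
  show thesis
  proof (rule that[of n])
    show "1 \<le> 2 ^ n * \<epsilon>" using n1 assms by (simp add: field_simps)
    show "2 ^ n * \<epsilon> \<le> 2" using n2 n0 assms by (cases n) (auto simp: field_simps)
    show "1 \<le> n" using n0 by simp
    have "ln (2 ^ (n - 1)) \<le> ln (1 / \<epsilon>)" using n2 assms by (subst ln_le_cancel_iff) auto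
    then show "(real n - 1) * ln 2 \<le> ln (1 / \<epsilon>)" using n0 by (simp add: ln_realpow of_nat_diff)
    fix m assume "\<epsilon> < 1 / 2 ^ m"
    then have "2 ^ m < 1 / \<epsilon>" using assms by (simp add: field_simps)
    also have "\<dots> \<le> 2 ^ n" by (rule n1)
    finally show "m < n" by simp
  qed
qed

theorem proposition1p7:
  fixes M :: "'w measure"
    and h :: "'w \<Rightarrow> ('a::euclidean_space \<Rightarrow> real) \<Rightarrow> real"
    and \<psi> :: "'a \<Rightarrow> real"
    and p :: real
    and \<rho> \<sigma> :: "'a measure"
    and h\<rho> h\<sigma> X :: "'a \<Rightarrow> real \<Rightarrow> 'w \<Rightarrow> real"
    and U :: "'a set"
  assumes "DIM('a) \<ge> 2"
    and "bump_kernel \<psi>"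
    and "LGF M \<psi> h"
    and "0 < p" and "p \<le> 1"
    and "admissible_mollifier \<rho>" and "admissible_mollifier \<sigma>"
    and "condition_A M \<psi> h p \<rho>" and "condition_A M \<psi> h p \<sigma>"
    and "mollified_field M \<psi> h \<rho> h\<rho>" and "mollified_field M \<psi> h \<sigma> h\<sigma>"
    and "\<And>z \<epsilon> \<omega>. X z \<epsilon> \<omega> = h\<rho> z \<epsilon> \<omega> - h\<sigma> z \<epsilon> \<omega>"
    and "open U" and "bounded U"
  shows "AE \<omega> in M. ((\<lambda>\<epsilon>. SUP z\<in>U. ennreal (\<bar>X z \<epsilon> \<omega>\<bar> / ln (1 / \<epsilon>))) \<longlongrightarrow> 0) (at_right 0)"
proof -
  note d = assms(1) and \<psi> = assms(2) and p = assms(4) and \<rho> = assms(6) and \<sigma> = assms(7)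
    and X = assms(12)
  have lgf: "LGF_mod_constants M h" and h: "random_functional M schwartz h"
    using assms(3) by (auto simp: LGF_def)
  interpret prob_space M using lgf by (simp add: LGF_mod_constants_def)
  have pair: "is_pairing M \<psi> h (rescaled \<rho> z \<epsilon>) (h\<rho> z \<epsilon>)" "is_pairing M \<psi> h (rescaled \<sigma> z \<epsilon>) (h\<sigma> z \<epsilon>)"
    if "0 < \<epsilon>" "\<epsilon> \<le> 1" for z \<epsilon>
    using assms(10,11) that by (auto simp: mollified_field_def)
  then have [measurable]: "h\<rho> z \<epsilon> \<in> borel_measurable M" "h\<sigma> z \<epsilon> \<in> borel_measurable M"
    if "0 < \<epsilon>" "\<epsilon> \<le> 1" for z \<epsilon>
    using that by (auto simp: is_pairing_def)

  \<comment> \<open>With this shift the bump has width at most \<open>\<epsilon>\<close> for every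
    \<open>n\<close>, as the support and energy estimates require.\<close>
  let ?f = "\<lambda>\<rho> z \<epsilon> n. measure_convolution (rescaled \<rho> z \<epsilon>) (bump_scaled \<psi> (n + nat \<lceil>1 / \<epsilon>\<rceil>))"
  have N: "1 \<le> real (nat \<lceil>1 / \<epsilon>\<rceil>) * \<epsilon>" if "0 < \<epsilon>" for \<epsilon> :: real
    using that real_nat_ceiling_ge[of "1 / \<epsilon>"] by (simp only: pos_divide_le_eq)
  define F where "F z \<epsilon> n x = ?f \<rho> z \<epsilon> n x - ?f \<sigma> z \<epsilon> n x" for z \<epsilon> n x
  have X_approx: "L2_approximated M h (X z \<epsilon>) (F z \<epsilon>)" if "0 < \<epsilon>" "\<epsilon> \<le> 1" for z \<epsilon>
  proof -
    have "X z \<epsilon> = (\<lambda>\<omega>. h\<rho> z \<epsilon> \<omega> - h\<sigma> z \<epsilon> \<omega>)" "F z \<epsilon> = (\<lambda>n x. ?f \<rho> z \<epsilon> n x - ?f \<sigma> z \<epsilon> n x)"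
      by (simp_all add: fun_eq_iff X F_def)
    then show ?thesis
      using L2_approximated_diff[OF h L2_approximated_pairing[OF \<psi> \<rho> that(1) N[OF that(1)] pair(1)[OF that]]
          L2_approximated_pairing[OF \<psi> \<sigma> that(1) N[OF that(1)] pair(2)[OF that]], of z z]
      by (simp only:)
  qed
  have F_test: "F z \<epsilon> n \<in> test_functions" if "0 < \<epsilon>" "\<epsilon> \<le> 1" for z \<epsilon> n
    using X_approx[OF that] by (simp add: L2_approximated_def)
  have F0: "(LINT x|lborel. F z \<epsilon> n x) = 0" if "0 < \<epsilon>" "\<epsilon> \<le> 1" for z \<epsilon> n
  proof -
    have "0 < n + nat \<lceil>1 / \<epsilon>\<rceil>" using that by simp
    from measure_convolution_bump[OF \<psi> this rescaled_prob_space[OF \<rho>]]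
      measure_convolution_bump[OF \<psi> this rescaled_prob_space[OF \<sigma>]]
    show ?thesis unfolding F_def by simp
  qed
  have gauss: "centered_gaussian M (\<lambda>\<omega>. h \<omega> f)" if "f \<in> test_functions" "(LINT x|lborel. f x) = 0" for f
    using lgf that test_functions_schwartz by (auto simp: LGF_mod_constants_def schwartz0_def)

  obtain C0 where C0: "0 \<le> C0" "\<And>n z \<epsilon> f. 0 < n \<Longrightarrow> 0 < \<epsilon> \<Longrightarrow> \<epsilon> \<le> 1 \<Longrightarrow> 1 \<le> real n * \<epsilon> \<Longrightarrow>
    f = (\<lambda>x. measure_convolution (rescaled \<rho> z \<epsilon>) (bump_scaled \<psi> n) x
           - measure_convolution (rescaled \<sigma> z \<epsilon>) (bump_scaled \<psi> n) x) \<Longrightarrow>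
    (LINT (x, y)|(lborel \<Otimes>\<^sub>M lborel). ln (1 / norm (x - y)) * f x * f y) \<le> C0"
    by (rule mollifier_difference_log_energy_bound[OF \<psi> d \<rho> \<sigma>]; blast)
  have var: "(\<integral>\<omega>. (h \<omega> (F z \<epsilon> n))\<^sup>2 \<partial>M) \<le> C0" if \<epsilon>: "0 < \<epsilon>" "\<epsilon> \<le> 1" for z \<epsilon> n
  proof -
    have s0: "F z \<epsilon> n \<in> schwartz0"
      using F_test[OF \<epsilon>, THEN test_functions_schwartz] F0[OF \<epsilon>] by (simp add: schwartz0_def)
    have "(\<integral>\<omega>. (h \<omega> (F z \<epsilon> n))\<^sup>2 \<partial>M) = covariance M (\<lambda>\<omega>. h \<omega> (F z \<epsilon> n)) (\<lambda>\<omega>. h \<omega> (F z \<epsilon> n))"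
      by (rule centered_gaussian_second_moment(3)[OF gauss[OF F_test[OF \<epsilon>] F0[OF \<epsilon>]], symmetric])
    also have "\<dots> = (LINT (x, y)|(lborel \<Otimes>\<^sub>M lborel). ln (1 / norm (x - y)) * F z \<epsilon> n x * F z \<epsilon> n y)"
      using lgf s0 unfolding LGF_mod_constants_def by blast
    also have "\<dots> \<le> C0"
    proof (rule C0(2)[OF _ \<epsilon>])
      have "real (nat \<lceil>1 / \<epsilon>\<rceil>) * \<epsilon> \<le> real (n + nat \<lceil>1 / \<epsilon>\<rceil>) * \<epsilon>" using \<epsilon> by (intro mult_right_mono) auto
      then show "1 \<le> real (n + nat \<lceil>1 / \<epsilon>\<rceil>) * \<epsilon>" using N[OF \<epsilon>(1)] by linarith
      show "0 < n + nat \<lceil>1 / \<epsilon>\<rceil>" using \<epsilon> by simp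
    qed (simp add: F_def[abs_def])
    finally show ?thesis .
  qed

  obtain C1 where C1: "\<forall>z w. \<forall>\<epsilon>\<in>{0<..1}. \<forall>r\<in>{0<..1}. 1/2 \<le> \<epsilon> / r \<longrightarrow> \<epsilon> / r \<le> 2 \<longrightarrow>
        (\<forall>Y Y'. is_pairing M \<psi> h (rescaled \<rho> z \<epsilon>) Y \<longrightarrow> is_pairing M \<psi> h (rescaled \<rho> w r) Y' \<longrightarrow>
           (\<integral>\<^sup>+ \<omega>. ennreal ((Y \<omega> - Y' \<omega>)\<^sup>2) \<partial>M)
             \<le> ennreal (C1 * (norm ((z, \<epsilon>) - (w, r)) / min \<epsilon> r) powr p))"
    using assms(8) unfolding condition_A_def by blast
  obtain C2 where C2: "\<forall>z w. \<forall>\<epsilon>\<in>{0<..1}. \<forall>r\<in>{0<..1}. 1/2 \<le> \<epsilon> / r \<longrightarrow> \<epsilon> / r \<le> 2 \<longrightarrow>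
        (\<forall>Y Y'. is_pairing M \<psi> h (rescaled \<sigma> z \<epsilon>) Y \<longrightarrow> is_pairing M \<psi> h (rescaled \<sigma> w r) Y' \<longrightarrow>
           (\<integral>\<^sup>+ \<omega>. ennreal ((Y \<omega> - Y' \<omega>)\<^sup>2) \<partial>M)
             \<le> ennreal (C2 * (norm ((z, \<epsilon>) - (w, r)) / min \<epsilon> r) powr p))"
    using assms(9) unfolding condition_A_def by blast
  \<comment> \<open>Condition $(A_p)$ does not fix the sign of its constant; the tail bound for
    increments asks for a positive variance bound.\<close>
  define C where "C = \<bar>C1\<bar> + \<bar>C2\<bar> + 1"
  have C: "0 < C" by (simp add: C_def)
  have incr: "(\<integral>\<^sup>+ \<omega>. ennreal ((X z \<epsilon> \<omega> - X w r \<omega>)\<^sup>2) \<partial>M) \<le> ennreal (2 * C * t)"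
    if \<epsilon>: "0 < \<epsilon>" "\<epsilon> \<le> 1" "0 < r" "r \<le> 1" "1/2 \<le> \<epsilon> / r" "\<epsilon> / r \<le> 2"
      and t: "(norm ((z, \<epsilon>) - (w, r)) / min \<epsilon> r) powr p \<le> t" for z w \<epsilon> r t
  proof -
    let ?t = "(norm ((z, \<epsilon>) - (w, r)) / min \<epsilon> r) powr p"
    have t0: "0 \<le> t" using t by (meson order_trans powr_ge_zero)
    have le: "ennreal (c * ?t) \<le> ennreal (\<bar>c\<bar> * t)" for c
      by (intro ennreal_leI mult_mono) (use t in auto)
    have "(\<integral>\<^sup>+ \<omega>. ennreal ((X z \<epsilon> \<omega> - X w r \<omega>)\<^sup>2) \<partial>M)
      \<le> 2 * (\<integral>\<^sup>+ \<omega>. ennreal ((h\<rho> z \<epsilon> \<omega> - h\<rho> w r \<omega>)\<^sup>2) \<partial>M)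
        + 2 * (\<integral>\<^sup>+ \<omega>. ennreal ((h\<sigma> z \<epsilon> \<omega> - h\<sigma> w r \<omega>)\<^sup>2) \<partial>M)"
      unfolding X by (rule nn_integral_power2_diff_le) (use \<epsilon> in measurable)
    also have "\<dots> \<le> 2 * ennreal (C1 * ?t) + 2 * ennreal (C2 * ?t)"
      using C1 C2 pair \<epsilon> by (intro add_mono mult_left_mono) auto
    also have "\<dots> \<le> 2 * ennreal (\<bar>C1\<bar> * t) + 2 * ennreal (\<bar>C2\<bar> * t)"
      by (intro add_mono mult_left_mono le) auto
    also have "\<dots> = ennreal (2 * (\<bar>C1\<bar> * t) + 2 * (\<bar>C2\<bar> * t))"
      using t0 by (simp add: ennreal_plus ennreal_mult')
    also have "\<dots> \<le> ennreal (2 * C * t)"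
      using t0 by (intro ennreal_leI) (simp add: C_def algebra_simps)
    finally show ?thesis .
  qed

  \<comment> \<open>The first entry serves the tail of a single value, with factor 16. The second
    serves increments: factor 48 times the variance bound \<open>2 * C * w\<close>.\<close>
  define v where "v = max (16 * (C0 + 1)) (96 * C)"
  have v: "0 < v" "16 * (C0 + 1) \<le> v" "96 * C \<le> v" using C0(1) by (auto simp: v_def)
  define S :: "('a \<times> real) set" where "S = UNIV \<times> {1..2}"
  \<comment> \<open>Space and scale blown up by \<open>2 ^ n\<close>, so that the scales between \<open>2 ^ -n\<close> and \<open>2 * 2 ^ -n\<close>
    become the interval \<open>{1..2}\<close> and Condition $(A_p)$ reads the same for every \<open>n\<close>.\<close>
  define Z where "Z n q = X (fst q /\<^sub>R 2 ^ n) (snd q / 2 ^ n)" for n :: nat and q :: "'a \<times> real"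
  \<comment> \<open>For \<open>n = 0\<close> the scale could reach 2, outside the domain of the
    mollified fields; hence \<open>1 \<le> n\<close>.\<close>
  have range: "0 < snd q / 2 ^ n" "snd q / 2 ^ n \<le> 1" if "1 \<le> n" "q \<in> S" for n q
  proof -
    have "(2::real) ^ 1 \<le> 2 ^ n" using that by (intro power_increasing) auto
    moreover have "snd q \<le> 2" "0 < snd q" using that by (auto simp: S_def mem_Times_iff)
    ultimately show "0 < snd q / 2 ^ n" "snd q / 2 ^ n \<le> 1" by (auto simp: field_simps)
  qed
  \<comment> \<open>The cube has to contain the blown-up scale coordinate as well, which is at most
    2.\<close>
  obtain R :: nat where R: "2 \<le> R" "\<And>z. z \<in> U \<Longrightarrow> norm z \<le> R"
  proof -
    obtain b where b: "\<And>z. z \<in> U \<Longrightarrow> norm z \<le> b" using assms(14) by (auto simp: bounded_iff)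
    show thesis
    proof (rule that[of "nat \<lceil>max 2 b\<rceil>"])
      show "norm z \<le> real (nat \<lceil>max 2 b\<rceil>)" if "z \<in> U" for z
        using b[OF that] real_nat_ceiling_ge[of "max 2 b"] by linarith
    qed linarith
  qed

  have chain: "AE \<omega> in M. \<forall>\<^sub>F n in sequentially.
     \<forall>q\<in>S. (\<forall>b\<in>Basis. \<bar>q \<bullet> b\<bar> \<le> real (R * 2 ^ n)) \<longrightarrow> \<bar>Z n q \<omega>\<bar> \<le> \<delta> * n" if \<delta>: "0 < \<delta>" for \<delta> :: real
  proof (rule chaining_bound[OF _ _ _ p v(1) _ _ \<delta>])
    show "Z n q \<in> borel_measurable M" if "1 \<le> n" "q \<in> S" for n q
      using X_approx[OF range[OF that]] by (simp add: L2_approximated_def Z_def)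
  next
    fix n :: nat and \<omega> assume n: "1 \<le> n" and \<omega>: "\<omega> \<in> space M"
    have "continuous_on (UNIV \<times> {0<..1}) (\<lambda>(z, \<epsilon>). h\<rho> z \<epsilon> \<omega>)" "continuous_on (UNIV \<times> {0<..1}) (\<lambda>(z, \<epsilon>). h\<sigma> z \<epsilon> \<omega>)"
      using assms(10,11) \<omega> by (auto simp: mollified_field_def)
    then have "continuous_on (UNIV \<times> {0<..1}) (\<lambda>w. X (fst w) (snd w) \<omega>)"
      unfolding X by (auto simp: case_prod_beta intro: continuous_on_diff)
    moreover have "continuous_on S (\<lambda>q. (fst q /\<^sub>R 2 ^ n, snd q / 2 ^ n))"
      by (intro continuous_intros) auto
    moreover have "(\<lambda>q. (fst q /\<^sub>R 2 ^ n, snd q / 2 ^ n)) ` S \<subseteq> UNIV \<times> {0<..1}"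
      using range[OF n] by auto
    ultimately show "continuous_on S (\<lambda>q. Z n q \<omega>)"
      unfolding Z_def using continuous_on_compose2 by fastforce
  next
    show "dyadic_floor k q \<in> S" if "q \<in> S" for k q
      using dyadic_floor_strip that by (simp add: S_def)
  next
    fix n :: nat and q a assume n: "1 \<le> n" and q: "q \<in> S" and a: "0 < (a::real)"
    note r = range[OF n q]
    have "prob {\<omega> \<in> space M. a \<le> \<bar>Z n q \<omega>\<bar>} \<le> 2 * exp (- a\<^sup>2 / (16 * (C0 + 1)))"
      unfolding Z_def
    proof (rule gaussian_tail_of_L2_limit[where Y="\<lambda>k \<omega>. h \<omega> (F (fst q /\<^sub>R 2 ^ n) (snd q / 2 ^ n) k)", OF _ _ _ _ a])
      show "\<forall>\<^sub>F k in sequentially. (\<integral>\<omega>. (h \<omega> (F (fst q /\<^sub>R 2 ^ n) (snd q / 2 ^ n) k))\<^sup>2 \<partial>M) \<le> C0 + 1"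
        using var[OF r] by (auto intro!: always_eventually intro: add_increasing2)
    qed (use X_approx[OF r] gauss[OF F_test[OF r] F0[OF r]] in \<open>auto simp: L2_approximated_def\<close>)
    also have "\<dots> \<le> 2 * exp (- a\<^sup>2 / v)"
    proof -
      have "a\<^sup>2 / v \<le> a\<^sup>2 / (16 * (C0 + 1))" using v C0(1) by (intro divide_left_mono) auto
      then show ?thesis by simp
    qed
    finally show "prob {\<omega> \<in> space M. a \<le> \<bar>Z n q \<omega>\<bar>} \<le> 2 * exp (- a\<^sup>2 / v)" .
  next
    fix n :: nat and q q' a w
    assume n: "1 \<le> n" and q: "q \<in> S" and q': "q' \<in> S" and a: "0 < (a::real)" and w: "0 < (w::real)"
      and le: "norm (q - q') powr p \<le> w"
    note r = range[OF n q] and r' = range[OF n q']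
    let ?z = "fst q /\<^sub>R 2 ^ n" and ?\<epsilon> = "snd q / 2 ^ n" and ?z' = "fst q' /\<^sub>R 2 ^ n" and ?\<epsilon>' = "snd q' / 2 ^ n"
    have s: "1 \<le> snd q" "snd q \<le> 2" "1 \<le> snd q'" "snd q' \<le> 2"
      using q q' by (auto simp: S_def mem_Times_iff)
    have "(?z, ?\<epsilon>) - (?z', ?\<epsilon>') = (q - q') /\<^sub>R 2 ^ n"
      by (auto simp: prod_eq_iff scaleR_diff_right divide_inverse algebra_simps)
    then have "norm ((?z, ?\<epsilon>) - (?z', ?\<epsilon>')) = norm (q - q') / 2 ^ n"
      by (simp add: divide_inverse mult.commute)
    \<comment> \<open>The smaller scale is at least \<open>1 / 2 ^ n\<close>, so the blow-up factor
      cancels from the quotient in Condition $(A_p)$.\<close>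
    moreover have "min ?\<epsilon> ?\<epsilon>' \<ge> 1 / 2 ^ n" using s by (simp add: divide_right_mono)
    ultimately have "norm ((?z, ?\<epsilon>) - (?z', ?\<epsilon>')) / min ?\<epsilon> ?\<epsilon>' \<le> (norm (q - q') / 2 ^ n) / (1 / 2 ^ n)"
      using r r' by (simp only:, intro divide_left_mono) auto
    then have "norm ((?z, ?\<epsilon>) - (?z', ?\<epsilon>')) / min ?\<epsilon> ?\<epsilon>' \<le> norm (q - q')" by simp
    then have "(norm ((?z, ?\<epsilon>) - (?z', ?\<epsilon>')) / min ?\<epsilon> ?\<epsilon>') powr p \<le> norm (q - q') powr p"
      using p r r' by (intro powr_mono2) (auto intro!: divide_nonneg_nonneg)
    then have t: "(norm ((?z, ?\<epsilon>) - (?z', ?\<epsilon>')) / min ?\<epsilon> ?\<epsilon>') powr p \<le> w" using le by linarith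
    \<comment> \<open>Two numbers between 1 and 2 have a ratio within the range where Condition
      $(A_p)$ speaks.\<close>
    have ratio: "1/2 \<le> ?\<epsilon> / ?\<epsilon>'" "?\<epsilon> / ?\<epsilon>' \<le> 2" using s by (auto simp: field_simps)
    have approx: "L2_approximated M h (\<lambda>\<omega>. Z n q \<omega> - Z n q' \<omega>) (\<lambda>k x. F ?z ?\<epsilon> k x - F ?z' ?\<epsilon>' k x)"
      unfolding Z_def by (rule L2_approximated_diff[OF h X_approx[OF r] X_approx[OF r']])
    have "prob {\<omega> \<in> space M. a \<le> \<bar>Z n q \<omega> - Z n q' \<omega>\<bar>} \<le> 2 * exp (- a\<^sup>2 / (48 * (2 * C * w)))"
    proof (rule gaussian_tail_of_L2_limit_norm[where Y="\<lambda>k \<omega>. h \<omega> (\<lambda>x. F ?z ?\<epsilon> k x - F ?z' ?\<epsilon>' k x)", OF _ _ _ _ _ a])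
      show "centered_gaussian M (\<lambda>\<omega>. h \<omega> (\<lambda>x. F ?z ?\<epsilon> k x - F ?z' ?\<epsilon>' k x))" for k
      proof (rule gauss)
        show "(\<lambda>x. F ?z ?\<epsilon> k x - F ?z' ?\<epsilon>' k x) \<in> test_functions"
          by (rule test_functions_diff[OF F_test[OF r] F_test[OF r']])
        show "(LINT x|lborel. F ?z ?\<epsilon> k x - F ?z' ?\<epsilon>' k x) = 0"
          using F_test[OF r, of ?z k] F_test[OF r', of ?z' k] F0[OF r, of ?z k] F0[OF r', of ?z' k]
          by (simp add: test_functions_def)
      qed
      show "(\<integral>\<^sup>+ \<omega>. ennreal ((Z n q \<omega> - Z n q' \<omega>)\<^sup>2) \<partial>M) \<le> ennreal (2 * C * w)"
        unfolding Z_def by (rule incr[OF r r' ratio t])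
    qed (use approx C w in \<open>auto simp: L2_approximated_def\<close>)
    also have "\<dots> \<le> 2 * exp (- a\<^sup>2 / (v * w))"
    proof -
      have "48 * (2 * C * w) \<le> v * w" using v w by simp
      then have "a\<^sup>2 / (v * w) \<le> a\<^sup>2 / (48 * (2 * C * w))" using v w C by (intro divide_left_mono) auto
      then show ?thesis by simp
    qed
    finally show "prob {\<omega> \<in> space M. a \<le> \<bar>Z n q \<omega> - Z n q' \<omega>\<bar>} \<le> 2 * exp (- a\<^sup>2 / (v * w))" .
  qed

  \<comment> \<open>Countably many tolerances give one null set for all of them.\<close>
  have "AE \<omega> in M. \<forall>j::nat. \<forall>\<^sub>F n in sequentially.
     \<forall>q\<in>S. (\<forall>b\<in>Basis. \<bar>q \<bullet> b\<bar> \<le> real (R * 2 ^ n)) \<longrightarrow> \<bar>Z n q \<omega>\<bar> \<le> 1 / Suc j * n"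
    unfolding AE_all_countable by (intro allI chain) simp
  then show ?thesis
  proof eventually_elim
    case (elim \<omega>)
    have small: "\<forall>\<^sub>F \<epsilon> in at_right 0. (SUP z\<in>U. ennreal (\<bar>X z \<epsilon> \<omega>\<bar> / ln (1 / \<epsilon>))) \<le> ennreal e" if e: "0 < e" for e
    proof -
      \<comment> \<open>Chosen so that \<open>1 / Suc j * n\<close> is at most
        \<open>e * (n / 2 * ln 2)\<close>, while \<open>n / 2 * ln 2\<close> will be at most
        \<open>ln (1 / \<epsilon>)\<close>.\<close>
      obtain j :: nat where j: "1 / Suc j < e * ln 2 / 2"
        using reals_Archimedean[of "e * ln 2 / 2"] e by (auto simp: inverse_eq_divide)
      from elim[rule_format, of j] obtain m where m: "\<And>n q. m \<le> n \<Longrightarrow> q \<in> S \<Longrightarrow>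
          (\<forall>b\<in>Basis. \<bar>q \<bullet> b\<bar> \<le> real (R * 2 ^ n)) \<Longrightarrow> \<bar>Z n q \<omega>\<bar> \<le> 1 / Suc j * n"
        unfolding eventually_sequentially by blast
      have "\<forall>\<^sub>F \<epsilon> in at_right 0. \<epsilon> \<in> {0<..<1 / 2 ^ Suc m :: real}"
        by (rule eventually_at_right_real) simp
      then show ?thesis
      proof eventually_elim
        case (elim \<epsilon>)
        have "(1::real) / 2 ^ Suc m \<le> 1" by (simp add: divide_le_eq_1 del: power_Suc)
        moreover have "0 < \<epsilon>" "\<epsilon> < 1 / 2 ^ Suc m" using elim by (simp_all del: power_Suc)
        ultimately have \<epsilon>: "0 < \<epsilon>" "\<epsilon> < 1" by linarith+
        obtain n :: nat where n: "1 \<le> 2 ^ n * \<epsilon>" "2 ^ n * \<epsilon> \<le> 2" "1 \<le> n" "(real n - 1) * ln 2 \<le> ln (1 / \<epsilon>)"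
            "\<And>m. \<epsilon> < 1 / 2 ^ m \<Longrightarrow> m < n"
          by (rule dyadic_scale[OF \<epsilon>]; blast)
        \<comment> \<open>The successor ensures \<open>n \<ge> 2\<close> even when
          \<open>m = 0\<close>, and therefore \<open>n / 2 \<le> n - 1\<close>.\<close>
        have mn: "Suc m < n" using n(5) elim by auto
        have "real n / 2 \<le> real n - 1" using mn by simp
        then have "real n / 2 * ln 2 \<le> (real n - 1) * ln 2" by (intro mult_right_mono) auto
        then have ln: "real n / 2 * ln 2 \<le> ln (1 / \<epsilon>)" using n(4) by linarith
        have "\<bar>X z \<epsilon> \<omega>\<bar> / ln (1 / \<epsilon>) \<le> e" if z: "z \<in> U" for z
        proof -
          let ?q = "(2 ^ n *\<^sub>R z, 2 ^ n * \<epsilon>)"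
          have "\<bar>Z n ?q \<omega>\<bar> \<le> 1 / Suc j * n"
          proof (rule m)
            show "m \<le> n" using mn by simp
            show "?q \<in> S" using n by (simp add: S_def)
            show "\<forall>b\<in>Basis. \<bar>?q \<bullet> b\<bar> \<le> real (R * 2 ^ n)"
            proof
              fix b :: "'a \<times> real" assume "b \<in> Basis"
              then consider b' where "b' \<in> Basis" "b = (b', 0)" | "b = (0, 1)" by (auto simp: Basis_prod_def)
              then show "\<bar>?q \<bullet> b\<bar> \<le> real (R * 2 ^ n)"
              proof cases
                case (1 b')
                have "\<bar>z \<bullet> b'\<bar> \<le> real R" using Basis_le_norm[OF 1(1), of z] R(2)[OF z] by linarith
                then show ?thesis using 1 by (simp add: abs_mult mult.commute)
              next
                case 2
                have "2 ^ n * \<epsilon> \<le> 2 * 1" using n by simp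
                also have "\<dots> \<le> real R * 2 ^ n" using R(1) by (intro mult_mono) auto
                finally show ?thesis using 2 \<epsilon> by (simp add: inner_prod_def)
              qed
            qed
          qed
          then have "\<bar>X z \<epsilon> \<omega>\<bar> \<le> 1 / Suc j * n" by (simp add: Z_def)
          also have "\<dots> \<le> e * ln 2 / 2 * n" using j by (intro mult_right_mono) auto
          also have "\<dots> = e * (real n / 2 * ln 2)" by simp
          also have "\<dots> \<le> e * ln (1 / \<epsilon>)" using ln e by (intro mult_left_mono) auto
          finally have "\<bar>X z \<epsilon> \<omega>\<bar> \<le> e * ln (1 / \<epsilon>)" .
          moreover have "0 < ln (1 / \<epsilon>)" using \<epsilon> by (simp add: ln_div)
          ultimately show ?thesis by (simp add: pos_divide_le_eq)
        qed
        then show ?case by (intro SUP_least ennreal_leI) auto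
      qed
    qed
    show ?case
    proof (rule order_tendstoI)
      fix a :: ennreal assume "0 < a"
      \<comment> \<open>An intermediate value is finite even if \<open>a\<close> is infinite, and it
        turns the weak inequality of \<open>small\<close> into a strict one.\<close>
      then obtain e where e: "0 < e" "e < a" using dense by blast
      then have "e \<noteq> \<top>" by auto
      then have "ennreal (enn2real e) = e" "0 < enn2real e"
        using e by (auto simp: ennreal_enn2real_if enn2real_positive_iff less_top)
      with small[of "enn2real e"] show "\<forall>\<^sub>F \<epsilon> in at_right 0. (SUP z\<in>U. ennreal (\<bar>X z \<epsilon> \<omega>\<bar> / ln (1 / \<epsilon>))) < a"
        using e by (auto elim!: eventually_mono)
    qed simp
  qed
qed
end
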